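(* Let $n\ge2$, $\alpha>\frac12$ and $\Psi(t)=t^{\frac12-\alpha}$. Then $R_{\frac{2n}{n+2},2}\log^\alpha(\mathbb{R}^n)\hookrightarrow T_\Psi(\mathbb{R}^n)$, and this embedding is strict: $R_{\frac{2n}{n+2},2}\log^\alpha(\mathbb{R}^n)\ne T_\Psi(\mathbb{R}^n)$.
   Context: $\mathcal{D}(\mathbb{R}^n)=\{2^{-k}(m+[0,1)^n):k\in\mathbb{Z},m\in\mathbb{Z}^n\}$. $R_{p,2}\log^\alpha(\mathbb{R}^n)$ is the set of $f\in L^1_{\mathrm{loc}}$ with $\sup\big\{\sum_i\big[(1-(\log|Q_i|)_-)^\alpha|Q_i|^{-1/p'}\int_{Q_i}|f|\big]^2\big\}^{1/2}<\infty$, the supremum over all families $(Q_i)$ of pairwise disjoint cubes in $\mathcal{D}(\mathbb{R}^n)$; $(a)_-=\min\{a,0\}$, $p'$ dual exponent. $\{\Delta_j\}_{j\in\mathbb{N}_0}$ are the standard inhomogeneous Littlewood–Paley operators; $T_\Psi(\mathbb{R}^n)$ is the set of $f\in\mathcal{S}'(\mathbb{R}^n)$ with $\|f\|^2_{T_\Psi}=\sup_{N\in\mathbb{N}_0}\Psi(N)^{-2}\sum_{j=N}^\infty2^{-2j}\|\Delta_jf\|^2_{L^2(\mathbb{R}^n)}<\infty$. *)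

theory Defs
  imports "HOL-Analysis.Analysis"
begin

definition dyadic_cube :: "int \<times> (int^'n) \<Rightarrow> (real^'n) set" where
  "dyadic_cube km = {x. \<forall>i. of_int ((snd km) $ i) \<le> 2 powr (of_int (fst km)) * x $ i
                         \<and> 2 powr (of_int (fst km)) * x $ i < of_int ((snd km) $ i) + 1}"

definition dyadic_vol :: "int \<times> (int^'n) \<Rightarrow> real" where
  "dyadic_vol km = (2 powr (- of_int (fst km))) ^ CARD('n)"

definition disjoint_dyadic_family :: "(int \<times> (int^'n)) set \<Rightarrow> bool" where
  "disjoint_dyadic_family S \<longleftrightarrow>
     (\<forall>Q\<in>S. \<forall>Q'\<in>S. Q \<noteq> Q' \<longrightarrow> dyadic_cube Q \<inter> dyadic_cube Q' = {})"

definition locally_integrable :: "(real^'n \<Rightarrow> complex) \<Rightarrow> bool" where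
  "locally_integrable f \<longleftrightarrow> f \<in> borel_measurable lebesgue \<and>
     (\<forall>K. compact K \<longrightarrow> set_integrable lebesgue K f)"

text \<open>Squared R_{p,2} log^alpha norm; 1/p' = 1 - 1/p, (a)_- = min a 0, log = ln.\<close>
definition R_sq :: "real \<Rightarrow> real \<Rightarrow> (real^'n \<Rightarrow> complex) \<Rightarrow> ennreal" where
  "R_sq p \<alpha> f = (SUP S\<in>{S. disjoint_dyadic_family S}.
      \<integral>\<^sup>+ Q. (ennreal ((1 - min (ln (dyadic_vol Q)) 0) powr \<alpha>
                          * dyadic_vol Q powr (- (1 - 1 / p)))
                * (\<integral>\<^sup>+ x\<in>dyadic_cube Q. ennreal (cmod (f x)) \<partial>lebesgue)) ^ 2
        \<partial>count_space S)"

definition R_log :: "real \<Rightarrow> real \<Rightarrow> (real^'n \<Rightarrow> complex) set" where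
  "R_log p \<alpha> = {f. locally_integrable f \<and> R_sq p \<alpha> f < \<infinity>}"

definition pderiv_dir :: "'n \<Rightarrow> (real^'n \<Rightarrow> complex) \<Rightarrow> real^'n \<Rightarrow> complex" where
  "pderiv_dir i f x = vector_derivative (\<lambda>t. f (x + t *\<^sub>R axis i 1)) (at 0)"

primrec pderivs :: "'n list \<Rightarrow> (real^'n \<Rightarrow> complex) \<Rightarrow> real^'n \<Rightarrow> complex" where
  "pderivs [] f = f"
| "pderivs (i # ds) f = pderiv_dir i (pderivs ds f)"

definition smooth_fun :: "(real^'n \<Rightarrow> complex) \<Rightarrow> bool" where
  "smooth_fun f \<longleftrightarrow> (\<forall>ds i x. (\<lambda>t. pderivs ds f (x + t *\<^sub>R axis i 1)) differentiable (at 0))"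

definition schwartz :: "(real^'n \<Rightarrow> complex) \<Rightarrow> bool" where
  "schwartz f \<longleftrightarrow> smooth_fun f \<and>
     (\<forall>ds N. \<exists>B. \<forall>x. (1 + norm x) ^ N * cmod (pderivs ds f x) \<le> B)"

definition schwartz_seminorm :: "nat \<Rightarrow> (real^'n \<Rightarrow> complex) \<Rightarrow> real" where
  "schwartz_seminorm N f =
     (\<Sum>ds\<in>{ds::'n list. length ds \<le> N}. SUP x. (1 + norm x) ^ N * cmod (pderivs ds f x))"

text \<open>Tempered distributions: continuous linear functionals on the Schwartz space
  (only their values on Schwartz functions matter).\<close>
definition tempered :: "((real^'n \<Rightarrow> complex) \<Rightarrow> complex) \<Rightarrow> bool" where
  "tempered u \<longleftrightarrow>
     (\<forall>\<phi> \<psi> a b. schwartz \<phi> \<longrightarrow> schwartz \<psi> \<longrightarrow>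
        u (\<lambda>x. a * \<phi> x + b * \<psi> x) = a * u \<phi> + b * u \<psi>) \<and>
     (\<exists>C N. \<forall>\<phi>. schwartz \<phi> \<longrightarrow> cmod (u \<phi>) \<le> C * schwartz_seminorm N \<phi>)"

definition dist_of :: "(real^'n \<Rightarrow> complex) \<Rightarrow> (real^'n \<Rightarrow> complex) \<Rightarrow> complex" where
  "dist_of f = (\<lambda>\<phi>. LINT x|lebesgue. f x * \<phi> x)"

definition LP_generator :: "(real^'n \<Rightarrow> real) \<Rightarrow> bool" where
  "LP_generator \<phi>0 \<longleftrightarrow> schwartz (\<lambda>\<xi>. complex_of_real (\<phi>0 \<xi>)) \<and>
     (\<forall>\<xi>. 0 \<le> \<phi>0 \<xi> \<and> \<phi>0 \<xi> \<le> 1) \<and>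
     (\<forall>\<xi>. norm \<xi> \<le> 1 \<longrightarrow> \<phi>0 \<xi> = 1) \<and>
     (\<forall>\<xi>. norm \<xi> \<ge> 2 \<longrightarrow> \<phi>0 \<xi> = 0)"

definition LP_symbol :: "(real^'n \<Rightarrow> real) \<Rightarrow> nat \<Rightarrow> real^'n \<Rightarrow> real" where
  "LP_symbol \<phi>0 j \<xi> = (if j = 0 then \<phi>0 \<xi>
      else \<phi>0 ((2 powr (- real j)) *\<^sub>R \<xi>) - \<phi>0 ((2 powr (1 - real j)) *\<^sub>R \<xi>))"

text \<open>Inverse Fourier transform of the symbol (Ff(xi) = int e^{-i x.xi} f(x) dx).\<close>
definition LP_kernel :: "(real^'n \<Rightarrow> real) \<Rightarrow> nat \<Rightarrow> real^'n \<Rightarrow> complex" where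
  "LP_kernel \<phi>0 j y = complex_of_real ((2 * pi) powr (- real CARD('n))) *
      (LINT \<xi>|lebesgue. cis (y \<bullet> \<xi>) * complex_of_real (LP_symbol \<phi>0 j \<xi>))"

text \<open>Delta_j u = F^{-1}(phi_j F u) = psi_j * u, i.e. (Delta_j u)(x) = u(psi_j(x - .)).\<close>
definition LP_op :: "(real^'n \<Rightarrow> real) \<Rightarrow> nat \<Rightarrow> ((real^'n \<Rightarrow> complex) \<Rightarrow> complex) \<Rightarrow> real^'n \<Rightarrow> complex" where
  "LP_op \<phi>0 j u x = u (\<lambda>y. LP_kernel \<phi>0 j (x - y))"

definition L2_sq :: "(real^'n \<Rightarrow> complex) \<Rightarrow> ennreal" where
  "L2_sq g = (\<integral>\<^sup>+ x. ennreal ((cmod (g x))\<^sup>2) \<partial>lebesgue)"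

definition T_sq :: "(real^'n \<Rightarrow> real) \<Rightarrow> (nat \<Rightarrow> real) \<Rightarrow> ((real^'n \<Rightarrow> complex) \<Rightarrow> complex) \<Rightarrow> ennreal" where
  "T_sq \<phi>0 \<Psi> u = (SUP N. ennreal ((\<Psi> N) powr (-2)) *
       (\<Sum>j. ennreal (2 powr (- 2 * real (j + N))) * L2_sq (LP_op \<phi>0 (j + N) u)))"

definition T_space :: "(real^'n \<Rightarrow> real) \<Rightarrow> (nat \<Rightarrow> real) \<Rightarrow> ((real^'n \<Rightarrow> complex) \<Rightarrow> complex) set" where
  "T_space \<phi>0 \<Psi> = {u. tempered u \<and> T_sq \<phi>0 \<Psi> u < \<infinity>}"

definition Psi_log :: "real \<Rightarrow> nat \<Rightarrow> real" where
  "Psi_log \<alpha> N = (real (max N 1)) powr (1/2 - \<alpha>)"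

end

theory Submission
  imports Defs
begin

text \<open>Let \<open>n = CARD('n)\<close>. On a dyadic cube of side length \<open>2 ^ - j\<close> the kernel of \<open>\<Delta>\<^sub>j\<close> varies only by a bounded factor and decays
  rapidly from cube to cube, so a discrete Schur test bounds \<open>\<parallel>\<Delta>\<^sub>j f\<parallel>\<^sup>2\<close> in \<open>L\<^sup>2\<close> by \<open>2 ^ (j n)\<close> times the sum of
  \<open>(\<integral>\<^bsub>Q\<^esub> \<bar>f\<bar>)\<^sup>2\<close> over the cubes \<open>Q\<close> of generation \<open>j\<close>. These cubes form one admissible disjoint family, hence
  \<open>2 ^ (- 2 j) \<parallel>\<Delta>\<^sub>j f\<parallel>\<^sup>2\<close> is at most a constant times \<open>(1 + j) powr (- 2 \<alpha>)\<close> times the squared \<open>R\<close>-norm, and summing over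
  \<open>j \<ge> N\<close> gives the embedding because \<open>2 \<alpha> > 1\<close>.

  The embedding is strict because the two norms behave differently at large scales: all of \<open>L\<^sup>2\<close> lies in the
  \<open>T\<close>-space, but \<open>(1 + \<bar>x\<bar>) powr (- (n + 1) / 2)\<close> has integrals over cubes of side \<open>2 ^ k\<close> of order \<open>2 powr (k (n - 1) / 2)\<close>,
  whereas the \<open>R\<close>-norm allows only \<open>2 powr (k (n - 2) / 2)\<close>. Testing against dilates of \<open>\<phi>0\<close> detects the
  difference at the level of distributions.\<close>

section \<open>Dyadic cubes and summation over the integer lattice\<close>

text \<open>The exponents \<open>1 + 1 / n\<close> each exceed 1 and add up to \<open>n + 1\<close>
  over the \<open>n\<close> coordinates. The product is therefore summable coordinate by coordinate
  and still dominates decay of order \<open>n + 1\<close> in the norm.\<close>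

definition lattice_weight :: "int^'n \<Rightarrow> real" where
  "lattice_weight m = (\<Prod>i\<in>UNIV. (1 + \<bar>real_of_int (m $ i)\<bar>) powr (- (1 + 1 / real CARD('n))))"

lemma lattice_weight_nonneg: "0 \<le> lattice_weight m"
  by (auto simp: lattice_weight_def intro!: prod_nonneg)

lemma lattice_weight_minus_commute: "lattice_weight (m - m') = lattice_weight (m' - m)"
  by (simp add: lattice_weight_def abs_minus_commute)

lemma finite_vec_box:
  assumes "finite A"
  shows "finite {m :: 'a^'n. \<forall>i. m $ i \<in> A}"
proof (rule finite_subset)
  show "{m :: 'a^'n. \<forall>i. m $ i \<in> A} \<subseteq> vec_lambda ` PiE UNIV (\<lambda>_. A)"
    by (auto simp: PiE_iff intro!: image_eqI[of _ _ "vec_nth _"])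
  show "finite (vec_lambda ` PiE (UNIV :: 'n set) (\<lambda>_. A))"
    using assms by (intro finite_imageI finite_PiE) auto
qed

lemma sum_symmetric_interval_powr_bounded:
  assumes "s > 1"
  shows "\<exists>B\<ge>0. \<forall>R. (\<Sum>k\<in>{- int R..int R}. (1 + \<bar>real_of_int k\<bar>) powr (- s)) \<le> B"
proof -
  have "summable (\<lambda>n. real n powr (- s))"
    using assms by (simp add: summable_real_powr_iff)
  then have sm: "summable (\<lambda>n. (1 + real n) powr (- s))"
    using summable_Suc_iff[of "\<lambda>n. real n powr (- s)"] by (simp add: add.commute)
  define B where "B = 2 * suminf (\<lambda>n. (1 + real n) powr (- s))"
  let ?g = "\<lambda>k. (1 + \<bar>real_of_int k\<bar>) powr (- s)"
  have "sum ?g {- int R..int R} \<le> B" for R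
  proof -
    \<comment> \<open>Splitting by sign covers zero twice, which is harmless for an upper
      bound.\<close>
    have "{- int R..int R} \<subseteq> int ` {..R} \<union> (\<lambda>n. - int n) ` {..R}" (is "_ \<subseteq> ?U \<union> ?V")
    proof
      fix k assume "k \<in> {- int R..int R}"
      then show "k \<in> int ` {..R} \<union> (\<lambda>n. - int n) ` {..R}"
        by (cases k rule: int_cases2) auto
    qed
    then have "sum ?g {- int R..int R} \<le> sum ?g (?U \<union> ?V)"
      by (intro sum_mono2) auto
    also have "\<dots> \<le> sum ?g ?U + sum ?g ?V"
      by (simp add: sum_Un sum_nonneg)
    also have "sum ?g ?U = (\<Sum>n\<le>R. (1 + real n) powr (- s))"
      by (subst sum.reindex) (auto simp: inj_on_def)
    also have "sum ?g ?V = (\<Sum>n\<le>R. (1 + real n) powr (- s))"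
      by (subst sum.reindex) (auto simp: inj_on_def)
    also have "(\<Sum>n\<le>R. (1 + real n) powr (- s)) + (\<Sum>n\<le>R. (1 + real n) powr (- s)) \<le> B"
      unfolding B_def using sum_le_suminf[OF sm, of "{..R}"] by simp
    finally show ?thesis .
  qed
  moreover have "0 \<le> B"
    unfolding B_def by (simp add: suminf_nonneg sm)
  ultimately show ?thesis by blast
qed

text \<open>Over the box with all coordinates in \<open>{- R..R}\<close> the sum of products is a
  product of one-dimensional sums, bounded independently of \<open>R\<close>. The boxes exhaust the
  lattice, and monotone convergence gives the full sum.\<close>

lemma lattice_weight_summable:
  "(\<integral>\<^sup>+ m. ennreal (lattice_weight (m :: int^'n)) \<partial>count_space UNIV) < \<infinity>"
proof -
  obtain B where B: "B \<ge> 0"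
    "\<And>R. (\<Sum>k\<in>{- int R..int R}. (1 + \<bar>real_of_int k\<bar>) powr (- (1 + 1 / real CARD('n)))) \<le> B"
    using sum_symmetric_interval_powr_bounded[of "1 + 1 / real CARD('n)"] by auto
  let ?A = "\<lambda>R. {m :: int^'n. \<forall>i. m $ i \<in> {- int R..int R}}"
  let ?E = "\<lambda>R. PiE (UNIV :: 'n set) (\<lambda>_. {- int R..int R})"
  have inj: "inj_on vec_nth (X :: (int^'n) set)" for X
    by (auto simp: inj_on_def vec_eq_iff)
  have im: "vec_nth ` ?A R = ?E R" for R
  proof (intro set_eqI iffI)
    fix g assume "g \<in> ?E R"
    then show "g \<in> vec_nth ` ?A R"
      by (intro image_eqI[of _ _ "vec_lambda g"]) (auto simp: PiE_iff)
  qed auto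
  have fin: "finite (?A R)" for R
    by (rule finite_vec_box) simp
  have bnd: "sum lattice_weight (?A R) \<le> B ^ CARD('n)" for R
  proof -
    have "sum lattice_weight (?A R)
        = (\<Sum>g\<in>?E R. \<Prod>i\<in>UNIV. (1 + \<bar>real_of_int (g i)\<bar>) powr (- (1 + 1 / real CARD('n))))"
      unfolding im[symmetric] by (subst sum.reindex[OF inj]) (simp add: lattice_weight_def)
    also have "\<dots> = (\<Prod>i\<in>(UNIV :: 'n set). \<Sum>k\<in>{- int R..int R}.
        (1 + \<bar>real_of_int k\<bar>) powr (- (1 + 1 / real CARD('n))))"
      by (subst prod_sum_PiE) auto
    also have "\<dots> = (\<Sum>k\<in>{- int R..int R}.
        (1 + \<bar>real_of_int k\<bar>) powr (- (1 + 1 / real CARD('n)))) ^ CARD('n)"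
      by simp
    also have "\<dots> \<le> B ^ CARD('n)"
      by (intro power_mono B sum_nonneg) auto
    finally show ?thesis .
  qed
  have sup: "(SUP R. ennreal (lattice_weight m) * indicator (?A R) m) = ennreal (lattice_weight m)" for m
  proof (rule antisym)
    show "(SUP R. ennreal (lattice_weight m) * indicator (?A R) m) \<le> ennreal (lattice_weight m)"
      by (intro SUP_least) (auto simp: indicator_def)
    \<comment> \<open>The l1 norm of \<open>m\<close> bounds each of its coordinates, so the box of
      this size contains \<open>m\<close>.\<close>
    define R where "R = (\<Sum>i\<in>UNIV. nat \<bar>m $ i\<bar>)"
    have "nat \<bar>m $ i\<bar> \<le> R" for i
      unfolding R_def by (intro member_le_sum) auto
    then have "m \<in> ?A R" by (auto simp: abs_le_iff nat_le_iff minus_le_iff)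
    then show "ennreal (lattice_weight m) \<le> (SUP R. ennreal (lattice_weight m) * indicator (?A R) m)"
      by (intro SUP_upper2[of R]) (auto simp: indicator_def)
  qed
  have "(\<integral>\<^sup>+ m. ennreal (lattice_weight (m :: int^'n)) \<partial>count_space UNIV)
      = (\<integral>\<^sup>+ m. (SUP R. ennreal (lattice_weight m) * indicator (?A R) m) \<partial>count_space UNIV)"
    by (simp only: sup)
  also have "\<dots> = (SUP R. \<integral>\<^sup>+ m. ennreal (lattice_weight m) * indicator (?A R) m \<partial>count_space UNIV)"
  proof (rule nn_integral_monotone_convergence_SUP)
    have "?A R \<subseteq> ?A R'" if "R \<le> R'" for R R'
    proof
      fix m :: "int^'n" assume "m \<in> ?A R"
      then have "m $ i \<in> {- int R'..int R'}" for i
        using that subsetD[of "{- int R..int R}" "{- int R'..int R'}" "m $ i"] by simp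
      then show "m \<in> ?A R'" by blast
    qed
    then show "incseq (\<lambda>R m. ennreal (lattice_weight m) * indicator (?A R) m)"
      by (intro incseq_SucI le_funI mult_left_mono indicator_leI) (blast intro: le_SucI, simp)
  qed simp
  also have "\<dots> \<le> ennreal (B ^ CARD('n))"
  proof (rule SUP_least)
    fix R
    have "(\<integral>\<^sup>+ m. ennreal (lattice_weight m) * indicator (?A R) m \<partial>count_space UNIV)
        = (\<Sum>m\<in>?A R. ennreal (lattice_weight m) * indicator (?A R) m)"
      by (rule nn_integral_count_space'[OF fin]) auto
    also have "\<dots> = ennreal (sum lattice_weight (?A R))"
      by (auto simp: lattice_weight_nonneg simp flip: sum_ennreal intro!: sum.cong)
    also have "\<dots> \<le> ennreal (B ^ CARD('n))"
      using bnd by (intro ennreal_leI)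
    finally show "(\<integral>\<^sup>+ m. ennreal (lattice_weight m) * indicator (?A R) m \<partial>count_space UNIV)
      \<le> ennreal (B ^ CARD('n))" .
  qed
  also have "\<dots> < \<infinity>" by simp
  finally show ?thesis .
qed

section \<open>Dyadic cubes of one generation as a partition of space\<close>

lemma mem_dyadic_cube_iff:
  "x \<in> dyadic_cube (k, m) \<longleftrightarrow> m = (\<chi> i. \<lfloor>2 powr of_int k * x $ i\<rfloor>)"
  by (auto simp: dyadic_cube_def vec_eq_iff floor_eq_iff eq_commute[of "_ $ _" "\<lfloor>_\<rfloor>"])

lemma dyadic_cube_disjoint: "m \<noteq> m' \<Longrightarrow> dyadic_cube (k, m) \<inter> dyadic_cube (k, m') = {}"
  by (auto simp: mem_dyadic_cube_iff)

lemma sets_dyadic_cube [measurable]: "dyadic_cube Q \<in> sets borel"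
  unfolding dyadic_cube_def by measurable

lemma sets_lebesgue_dyadic_cube [measurable]: "dyadic_cube Q \<in> sets lebesgue"
  by (intro sets_completionI_sets) simp

text \<open>The half-open cube lies in a closed box with the same side lengths, whose measure is
  their product.\<close>

lemma emeasure_dyadic_cube_le: "emeasure lebesgue (dyadic_cube Q) \<le> ennreal (dyadic_vol (Q :: int \<times> (int^'n)))"
proof -
  obtain k m where Q: "Q = (k, m)" by (cases Q)
  define s where "s = 2 powr (- real_of_int k)"
  have s: "s > 0" "2 powr real_of_int k = 1 / s" by (simp_all add: s_def powr_minus field_simps)
  define a :: "real^'n" where "a = (\<chi> i. s * m $ i)"
  define b :: "real^'n" where "b = (\<chi> i. s * (m $ i + 1))"
  have "dyadic_cube Q \<subseteq> cbox a b"
  proof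
    fix x assume x: "x \<in> dyadic_cube Q"
    have "real_of_int (m $ i) \<le> x $ i / s \<and> x $ i / s \<le> real_of_int (m $ i) + 1" for i
      using x by (simp add: dyadic_cube_def Q s less_imp_le)
    then have "s * real_of_int (m $ i) \<le> x $ i \<and> x $ i \<le> s * (real_of_int (m $ i) + 1)" for i
      using s(1) by (simp add: pos_le_divide_eq pos_divide_le_eq mult.commute)
    then show "x \<in> cbox a b"
      by (simp add: mem_box_cart a_def b_def)
  qed
  then have "emeasure lebesgue (dyadic_cube Q) \<le> emeasure lebesgue (cbox a b)"
    by (intro emeasure_mono) auto
  also have "\<dots> = ennreal (measure lborel (cbox a b))"
    using emeasure_lborel_cbox_finite[of a b] by (simp add: emeasure_eq_ennreal_measure less_top)
  also have "measure lborel (cbox a b) = dyadic_vol Q"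
  proof (subst content_cbox_cart)
    have "a \<in> cbox a b" using s by (auto simp: mem_box_cart a_def b_def)
    then show "cbox a b \<noteq> {}" by blast
    show "(\<Prod>i\<in>UNIV. b $ i - a $ i) = dyadic_vol Q"
      by (simp add: a_def b_def dyadic_vol_def s_def Q algebra_simps)
  qed
  finally show ?thesis .
qed

text \<open>A point lies in exactly one cube of generation \<open>k\<close>, indexed by the floor of
  its rescaled coordinates, so a single term survives. Cube-by-cube bounds become pointwise ones in
  this way.\<close>

lemma lattice_sum_indicator_dyadic_cube:
  "(\<integral>\<^sup>+ m. c m * indicator (dyadic_cube (k, m)) x \<partial>count_space UNIV) = c (\<chi> i. \<lfloor>2 powr of_int k * x $ i\<rfloor>)"
  by (subst nn_integral_count_space'[where A = "{\<chi> i. \<lfloor>2 powr of_int k * x $ i\<rfloor>}"])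
    (auto simp: mem_dyadic_cube_iff indicator_def)

lemma nn_integral_dyadic_partition:
  assumes [measurable]: "h \<in> borel_measurable lebesgue"
  shows "(\<integral>\<^sup>+ x. h x \<partial>lebesgue)
    = (\<integral>\<^sup>+ m. (\<integral>\<^sup>+ x\<in>dyadic_cube (k, m). h x \<partial>lebesgue) \<partial>count_space UNIV)"
proof -
  have "(\<integral>\<^sup>+ x. h x \<partial>lebesgue)
      = (\<integral>\<^sup>+ x. (\<integral>\<^sup>+ m. h x * indicator (dyadic_cube (k, m)) x \<partial>count_space UNIV) \<partial>lebesgue)"
    by (simp add: lattice_sum_indicator_dyadic_cube)
  also have "\<dots> = (\<integral>\<^sup>+ m. (\<integral>\<^sup>+ x\<in>dyadic_cube (k, m). h x \<partial>lebesgue) \<partial>count_space UNIV)"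
    by (intro nn_integral_count_space_nn_integral) auto
  finally show ?thesis .
qed

text \<open>In each coordinate the indices of the two cubes differ by at most one more than the
  rescaled distance of \<open>x\<close> and \<open>y\<close>. Every factor of the weight thus has a
  base of at most \<open>2 * t\<close>, and the \<open>n\<close> exponents \<open>1 + 1 / n\<close>
  combine to the power \<open>n + 1\<close>.\<close>

lemma inverse_bracket_le_lattice_weight:
  fixes x y :: "real^'n"
  assumes x: "x \<in> dyadic_cube (k, m)" and y: "y \<in> dyadic_cube (k, m')"
  shows "1 / (1 + 2 powr of_int k * norm (x - y)) ^ (CARD('n) + 1)
    \<le> 2 ^ (CARD('n) + 1) * lattice_weight (m - m')"
proof -
  define N where "N = CARD('n) + 1"
  define s where "s = 1 + 1 / real CARD('n)"
  define t where "t = 1 + 2 powr of_int k * norm (x - y)"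
  have t: "t \<ge> 1" by (simp add: t_def)
  have s: "s * CARD('n) = N" by (simp add: s_def N_def field_simps)
  have le: "1 + \<bar>real_of_int ((m - m') $ i)\<bar> \<le> 2 * t" for i
  proof -
    have *: "a \<le> 1 + b \<Longrightarrow> 0 \<le> b \<Longrightarrow> 1 + a \<le> 2 * (1 + b)" for a b :: real
      by simp
    define l where "l = (2::real) powr of_int k"
    have "\<bar>(x - y) $ i\<bar> \<le> norm (x - y)" by (rule component_le_norm_cart)
    then have "l * \<bar>(x - y) $ i\<bar> \<le> l * norm (x - y)"
      by (intro mult_left_mono) (auto simp: l_def)
    moreover have "l * \<bar>(x - y) $ i\<bar> = \<bar>l * x $ i - l * y $ i\<bar>"
      by (simp add: l_def abs_mult flip: right_diff_distrib)
    moreover have "of_int (m $ i) \<le> l * x $ i" "l * x $ i < of_int (m $ i) + 1"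
      "of_int (m' $ i) \<le> l * y $ i" "l * y $ i < of_int (m' $ i) + 1"
      using x y by (auto simp: dyadic_cube_def l_def)
    ultimately have "\<bar>real_of_int ((m - m') $ i)\<bar> \<le> 1 + l * norm (x - y)"
      by (auto simp: abs_le_iff abs_if split: if_splits)
    moreover have "0 \<le> l * norm (x - y)" by (simp add: l_def)
    ultimately have "1 + \<bar>real_of_int ((m - m') $ i)\<bar> \<le> 2 * (1 + l * norm (x - y))"
      using *[of "\<bar>real_of_int ((m - m') $ i)\<bar>"] by blast
    then show ?thesis by (simp add: t_def l_def)
  qed
  have "1 / (2 * t) ^ N = (\<Prod>i\<in>(UNIV :: 'n set). (2 * t) powr (- s))"
  proof -
    have "(\<Prod>i\<in>(UNIV :: 'n set). (2 * t) powr (- s)) = (2 * t) powr (- s * CARD('n))"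
      using t by (simp add: powr_power mult.commute)
    also have "\<dots> = 1 / (2 * t) ^ N"
      using t by (simp only: mult_minus_left s) (simp add: powr_minus powr_realpow divide_inverse)
    finally show ?thesis ..
  qed
  also have "\<dots> \<le> lattice_weight (m - m')"
    unfolding lattice_weight_def s_def[symmetric]
    using le by (intro prod_mono conjI powr_mono2') (auto simp: s_def intro: order_trans[of _ 0])
  finally have "2 ^ N * (1 / (2 * t) ^ N) \<le> 2 ^ N * lattice_weight (m - m')"
    by (rule mult_left_mono) simp
  then show ?thesis
    unfolding t_def[symmetric] N_def[symmetric] by (simp add: power_mult_distrib)
qed

section \<open>Schwartz functions\<close>

lemma pderivs_append: "pderivs (as @ bs) f = pderivs as (pderivs bs f)"
  by (induction as) auto

lemma schwartz_pderivs: "schwartz \<phi> \<Longrightarrow> schwartz (pderivs ds \<phi>)"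
  unfolding schwartz_def smooth_fun_def by (simp flip: pderivs_append)

text \<open>\<open>smooth_fun\<close> speaks of differentiability at parameter 0 only. Moving the
  base point along the line gives every parameter \<open>s\<close>.\<close>

lemma has_vector_derivative_pderiv_dir:
  fixes \<phi> :: "real^'n \<Rightarrow> complex"
  assumes "smooth_fun \<phi>"
  shows "((\<lambda>t. \<phi> (x + t *\<^sub>R axis i 1)) has_vector_derivative pderiv_dir i \<phi> (x + s *\<^sub>R axis i 1)) (at s)"
proof -
  let ?y = "x + s *\<^sub>R axis i 1"
  have "(\<lambda>t. \<phi> (?y + t *\<^sub>R axis i 1)) differentiable (at 0)"
    using assms unfolding smooth_fun_def by (metis pderivs.simps(1))
  then have "((\<lambda>t. \<phi> (?y + t *\<^sub>R axis i 1)) has_vector_derivative pderiv_dir i \<phi> ?y) (at 0)"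
    by (simp add: pderiv_dir_def vector_derivative_works)
  then have "((\<lambda>t. \<phi> (?y + t *\<^sub>R axis i 1)) has_vector_derivative pderiv_dir i \<phi> ?y) (at (s - s))"
    by simp
  then have "((\<lambda>t. \<phi> (?y + t *\<^sub>R axis i 1)) \<circ> (\<lambda>t. t - s) has_vector_derivative 1 *\<^sub>R pderiv_dir i \<phi> ?y) (at s)"
    by (intro vector_diff_chain_at) (auto intro!: derivative_eq_intros)
  moreover have "(\<lambda>t. \<phi> (?y + t *\<^sub>R axis i 1)) \<circ> (\<lambda>t. t - s) = (\<lambda>t. \<phi> (x + t *\<^sub>R axis i 1))"
    by (auto simp: fun_eq_iff algebra_simps)
  ultimately show ?thesis by simp
qed

lemma schwartz_decay:
  fixes \<phi> :: "real^'n \<Rightarrow> complex"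
  assumes "schwartz \<phi>"
  obtains B where "B \<ge> 0" "\<And>x. cmod (pderivs ds \<phi> x) \<le> B / (1 + norm x) ^ N"
proof -
  obtain B where B: "\<And>x. (1 + norm x) ^ N * cmod (pderivs ds \<phi> x) \<le> B"
    using assms unfolding schwartz_def by blast
  have "0 \<le> (1 + norm (0::real^'n)) ^ N * cmod (pderivs ds \<phi> 0)" by simp
  also have "\<dots> \<le> B" by (rule B)
  finally have "B \<ge> 0" .
  moreover have "cmod (pderivs ds \<phi> x) \<le> B / (1 + norm x) ^ N" for x
    using B[of x] by (subst pos_le_divide_eq) (auto simp: add_pos_nonneg mult.commute)
  ultimately show ?thesis using that by blast
qed

lemma schwartz_seminorm_bound:
  fixes \<phi> :: "real^'n \<Rightarrow> complex"
  assumes "schwartz \<phi>"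
  shows "(1 + norm x) ^ N * cmod (\<phi> x) \<le> schwartz_seminorm N \<phi>"
proof -
  have fin: "finite {ds :: 'n list. length ds \<le> N}"
    using finite_lists_length_le[of "UNIV :: 'n set" N] by simp
  have bdd: "bdd_above (range (\<lambda>x. (1 + norm x) ^ N * cmod (pderivs ds \<phi> x)))" for ds
    using assms unfolding schwartz_def bdd_above_def by blast
  have nn: "0 \<le> (SUP x. (1 + norm x) ^ N * cmod (pderivs ds \<phi> x))" for ds
    by (rule cSUP_upper2[OF bdd, of 0]) auto
  have "(1 + norm x) ^ N * cmod (\<phi> x) \<le> (SUP x. (1 + norm x) ^ N * cmod (pderivs [] \<phi> x))"
    using cSUP_upper[OF UNIV_I bdd, of x "[]"] by simp
  also have "\<dots> \<le> schwartz_seminorm N \<phi>"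
    unfolding schwartz_seminorm_def
    using member_le_sum[OF _ _ fin, of "[]" "\<lambda>ds. SUP x. (1 + norm x) ^ N * cmod (pderivs ds \<phi> x)"] nn
    by auto
  finally show ?thesis .
qed

text \<open>Mean value inequality with the derivative bounded only between 0 and \<open>t\<close>,
  for either sign of \<open>t\<close>. The local bound is what later allows decaying majorants of
  difference quotients.\<close>

lemma norm_increment_le_vector_derivative_bound:
  fixes f :: "real \<Rightarrow> 'b::real_normed_vector"
  assumes f: "\<And>s. (f has_vector_derivative f' s) (at s)"
    and B: "\<And>s. s \<in> closed_segment 0 t \<Longrightarrow> norm (f' s) \<le> B"
  shows "norm (f t - f 0) \<le> B * \<bar>t\<bar>"
proof -
  have "norm (f t - f 0) \<le> B * norm (t - 0)"
  proof (rule differentiable_bound[where S = "closed_segment 0 t" and f' = "\<lambda>s h. h *\<^sub>R f' s"])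
    show "(f has_derivative (\<lambda>h. h *\<^sub>R f' s)) (at s within closed_segment 0 t)" for s
      using f[of s] by (auto simp: has_vector_derivative_def intro: has_derivative_at_withinI)
    show "onorm (\<lambda>h. h *\<^sub>R f' s) \<le> B" if s: "s \<in> closed_segment 0 t" for s
    proof (rule onorm_bound)
      show "norm (h *\<^sub>R f' s) \<le> B * norm h" for h
        using B[OF s] by (simp add: mult.commute[of B] mult_left_mono)
      show "B \<ge> 0" using order_trans[OF norm_ge_zero B[of 0]] by simp
    qed
  qed auto
  then show ?thesis by simp
qed

text \<open>\<open>smooth_fun\<close> only provides derivatives along coordinate axes, so joint
  continuity has to be derived. Passing from \<open>x\<close> to \<open>y\<close> one coordinate at
  a time, each move costs at most the supremum of one partial derivative.\<close>

lemma schwartz_lipschitz: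
  fixes \<phi> :: "real^'n \<Rightarrow> complex"
  assumes "schwartz \<phi>"
  obtains L where "L \<ge> 0" "\<And>x y. cmod (\<phi> y - \<phi> x) \<le> L * norm (y - x)"
proof -
  have sm: "smooth_fun \<phi>" using assms by (simp add: schwartz_def)
  have "\<exists>B\<ge>0. \<forall>x. cmod (pderiv_dir i \<phi> x) \<le> B" for i
    using schwartz_decay[OF assms, of "[i]" 0] by auto
  then obtain B where B: "\<And>i. B i \<ge> 0" "\<And>i x. cmod (pderiv_dir i \<phi> x) \<le> B i" by metis
  have step: "cmod (\<phi> (x + t *\<^sub>R axis i 1) - \<phi> x) \<le> B i * \<bar>t\<bar>" for x t i
    using norm_increment_le_vector_derivative_bound[OF has_vector_derivative_pderiv_dir[OF sm, of x i], of t "B i"] B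
    by simp
  \<comment> \<open>Induction on the set \<open>S\<close> of coordinates that have already been
    switched from \<open>x\<close> to \<open>y\<close>.\<close>
  have "cmod (\<phi> (\<chi> i. if i \<in> S then y $ i else x $ i) - \<phi> x) \<le> (\<Sum>i\<in>S. B i * \<bar>y $ i - x $ i\<bar>)"
    if "finite S" for S and x y :: "real^'n"
    using that
  proof (induction S)
    case empty
    then show ?case by simp
  next
    case (insert j S)
    let ?z = "\<lambda>S. \<chi> i. if i \<in> S then y $ i else x $ i"
    have "?z (insert j S) = ?z S + (y $ j - x $ j) *\<^sub>R axis j 1"
      using insert by (auto simp: vec_eq_iff axis_def)
    then have "cmod (\<phi> (?z (insert j S)) - \<phi> (?z S)) \<le> B j * \<bar>y $ j - x $ j\<bar>"
      using step[of "?z S" "y $ j - x $ j" j] by (simp only:)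
    moreover have "cmod (\<phi> (?z (insert j S)) - \<phi> x) \<le> cmod (\<phi> (?z (insert j S)) - \<phi> (?z S)) + cmod (\<phi> (?z S) - \<phi> x)"
      using norm_triangle_ineq[of "\<phi> (?z (insert j S)) - \<phi> (?z S)" "\<phi> (?z S) - \<phi> x"] by simp
    ultimately show ?case using insert by simp
  qed
  from this[of UNIV] have *: "cmod (\<phi> y - \<phi> x) \<le> (\<Sum>i\<in>UNIV. B i * \<bar>y $ i - x $ i\<bar>)" for x y by simp
  have "cmod (\<phi> y - \<phi> x) \<le> sum B UNIV * norm (y - x)" for x y
  proof -
    have "(\<Sum>i\<in>UNIV. B i * \<bar>y $ i - x $ i\<bar>) \<le> (\<Sum>i\<in>UNIV. B i * norm (y - x))"
      using B(1) component_le_norm_cart[of "y - x"] by (intro sum_mono mult_left_mono) auto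
    then show ?thesis using order_trans[OF *] by (simp add: sum_distrib_right)
  qed
  moreover have "0 \<le> sum B UNIV" by (intro sum_nonneg B)
  ultimately show ?thesis using that by blast
qed

lemma schwartz_continuous: "schwartz \<phi> \<Longrightarrow> continuous_on UNIV \<phi>"
proof -
  assume "schwartz \<phi>"
  then obtain L where "L \<ge> 0" "\<And>x y. cmod (\<phi> y - \<phi> x) \<le> L * norm (y - x)"
    using schwartz_lipschitz by blast
  then have "L-lipschitz_on UNIV \<phi>" by (auto simp: lipschitz_on_def dist_norm)
  then show ?thesis by (rule lipschitz_on_continuous_on)
qed

lemma schwartz_borel_measurable: "schwartz \<phi> \<Longrightarrow> \<phi> \<in> borel_measurable borel"
  by (intro borel_measurable_continuous_onI schwartz_continuous)

text \<open>Chain rule: each differentiation of a dilate contributes a factor \<open>c\<close>. The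
  second claim records differentiability itself, which an equation between values of
  \<open>vector_derivative\<close> does not convey and which \<open>smooth_fun\<close>
  demands.\<close>

lemma pderivs_scaleR:
  assumes "smooth_fun \<phi>"
  shows "pderivs ds (\<lambda>x. \<phi> (c *\<^sub>R x)) = (\<lambda>x. c ^ length ds *\<^sub>R pderivs ds \<phi> (c *\<^sub>R x))"
    and "((\<lambda>t. pderivs ds (\<lambda>x. \<phi> (c *\<^sub>R x)) (x + t *\<^sub>R axis i 1)) has_vector_derivative
      c ^ Suc (length ds) *\<^sub>R pderivs (i # ds) \<phi> (c *\<^sub>R x)) (at 0)"
proof -
  have der: "((\<lambda>t. c ^ length ds *\<^sub>R pderivs ds \<phi> (c *\<^sub>R (x + t *\<^sub>R axis i 1))) has_vector_derivative
      c ^ Suc (length ds) *\<^sub>R pderivs (i # ds) \<phi> (c *\<^sub>R x)) (at 0)" for ds x i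
  proof -
    have sm: "smooth_fun (pderivs ds \<phi>)"
      using assms by (simp add: smooth_fun_def flip: pderivs_append)
    have "((\<lambda>t. pderivs ds \<phi> (c *\<^sub>R x + t *\<^sub>R axis i 1)) has_vector_derivative pderivs (i # ds) \<phi> (c *\<^sub>R x)) (at (c * 0))"
      using has_vector_derivative_pderiv_dir[OF sm, of "c *\<^sub>R x" i 0] by simp
    then have "((\<lambda>t. pderivs ds \<phi> (c *\<^sub>R x + t *\<^sub>R axis i 1)) \<circ> (\<lambda>t. c * t) has_vector_derivative c *\<^sub>R pderivs (i # ds) \<phi> (c *\<^sub>R x)) (at 0)"
      by (intro vector_diff_chain_at) (auto intro!: derivative_eq_intros)
    then have "((\<lambda>t. pderivs ds \<phi> (c *\<^sub>R (x + t *\<^sub>R axis i 1))) has_vector_derivative c *\<^sub>R pderivs (i # ds) \<phi> (c *\<^sub>R x)) (at 0)"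
      by (simp add: o_def algebra_simps)
    then have "((\<lambda>t. c ^ length ds *\<^sub>R pderivs ds \<phi> (c *\<^sub>R (x + t *\<^sub>R axis i 1))) has_vector_derivative c ^ length ds *\<^sub>R c *\<^sub>R pderivs (i # ds) \<phi> (c *\<^sub>R x)) (at 0)"
      by (rule bounded_linear.has_vector_derivative[OF bounded_linear_scaleR_right])
    then show ?thesis by (simp add: mult.commute)
  qed
  show eq: "pderivs ds (\<lambda>x. \<phi> (c *\<^sub>R x)) = (\<lambda>x. c ^ length ds *\<^sub>R pderivs ds \<phi> (c *\<^sub>R x))" for ds
  proof (induction ds)
    case (Cons i ds)
    show ?case
      by (subst pderivs.simps, subst Cons, rule ext, subst pderiv_dir_def)
        (use der[THEN vector_derivative_at] in simp)
  qed simp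
  show "((\<lambda>t. pderivs ds (\<lambda>x. \<phi> (c *\<^sub>R x)) (x + t *\<^sub>R axis i 1)) has_vector_derivative
      c ^ Suc (length ds) *\<^sub>R pderivs (i # ds) \<phi> (c *\<^sub>R x)) (at 0)"
    unfolding eq by (rule der)
qed

lemma schwartz_scaleR:
  fixes \<phi> :: "real^'n \<Rightarrow> complex"
  assumes "schwartz \<phi>" "0 < c"
  shows "schwartz (\<lambda>x. \<phi> (c *\<^sub>R x))"
  unfolding schwartz_def
proof (intro conjI allI)
  have sm: "smooth_fun \<phi>" using assms by (simp add: schwartz_def)
  show "smooth_fun (\<lambda>x. \<phi> (c *\<^sub>R x))"
    unfolding smooth_fun_def using pderivs_scaleR(2)[OF sm, of _ c, THEN differentiableI_vector] by blast
  fix ds :: "'n list" and N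
  obtain B where B: "\<And>x. (1 + norm x) ^ N * cmod (pderivs ds \<phi> x) \<le> B"
    using assms unfolding schwartz_def by blast
  \<comment> \<open>This factor compares \<open>1 + norm x\<close> with
    \<open>1 + c * norm x\<close>, whether \<open>c\<close> is small or large.\<close>
  define r where "r = 1 + 1 / c"
  have "(1 + norm x) ^ N * cmod (pderivs ds (\<lambda>x. \<phi> (c *\<^sub>R x)) x) \<le> c ^ length ds * r ^ N * B" for x
  proof -
    have "1 + norm x \<le> r * (1 + norm (c *\<^sub>R x))"
      using assms by (simp add: r_def field_simps)
    then have "(1 + norm x) ^ N \<le> r ^ N * (1 + norm (c *\<^sub>R x)) ^ N"
      using power_mono[of "1 + norm x" "r * (1 + norm (c *\<^sub>R x))" N] by (simp only: power_mult_distrib) simp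
    then have "(1 + norm x) ^ N * cmod (pderivs ds \<phi> (c *\<^sub>R x)) \<le> r ^ N * ((1 + norm (c *\<^sub>R x)) ^ N * cmod (pderivs ds \<phi> (c *\<^sub>R x)))"
      using mult_right_mono[OF _ norm_ge_zero[of "pderivs ds \<phi> (c *\<^sub>R x)"]] unfolding mult.assoc[symmetric] by blast
    also have "\<dots> \<le> r ^ N * B"
      using assms by (intro mult_left_mono B) (auto simp: r_def)
    finally show ?thesis
      using assms by (simp add: pderivs_scaleR(1)[OF sm] mult.left_commute[of _ "c ^ length ds"] mult.assoc)
  qed
  then show "\<exists>B. \<forall>x. (1 + norm x) ^ N * cmod (pderivs ds (\<lambda>x. \<phi> (c *\<^sub>R x)) x) \<le> B"
    by blast
qed

section \<open>Decay of Littlewood--Paley kernels\<close>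

text \<open>The integral is split over unit cubes. Comparing with the point 0, which lies in the
  cube of index 0, bounds the piece over the cube \<open>m\<close> by a multiple of
  \<open>lattice_weight m\<close>, and these are summable.\<close>

lemma nn_integral_bracket_finite:
  "(\<integral>\<^sup>+ x. ennreal (1 / (1 + norm (x::real^'n)) ^ (CARD('n) + 1)) \<partial>lebesgue) < \<infinity>"
proof -
  let ?h = "\<lambda>x::real^'n. 1 / (1 + norm x) ^ (CARD('n) + 1)"
  have m: "(\<lambda>x. ennreal (?h x)) \<in> borel_measurable lebesgue"
    by (intro measurable_completion) measurable
  have cube: "(\<integral>\<^sup>+ x\<in>dyadic_cube (0, m). ennreal (?h x) \<partial>lebesgue)
      \<le> 2 ^ (CARD('n) + 1) * ennreal (lattice_weight m)" for m
  proof -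
    have "0 \<in> dyadic_cube (0, 0 :: int^'n)" by (auto simp: dyadic_cube_def)
    then have "?h x \<le> 2 ^ (CARD('n) + 1) * lattice_weight m" if "x \<in> dyadic_cube (0, m)" for x
      using inverse_bracket_le_lattice_weight[OF that] by fastforce
    then have "(\<integral>\<^sup>+ x\<in>dyadic_cube (0, m). ennreal (?h x) \<partial>lebesgue)
      \<le> (\<integral>\<^sup>+ x\<in>dyadic_cube (0, m). ennreal (2 ^ (CARD('n) + 1) * lattice_weight m) \<partial>lebesgue)"
      by (intro nn_integral_mono) (auto simp: indicator_def intro!: ennreal_leI)
    also have "\<dots> \<le> ennreal (2 ^ (CARD('n) + 1) * lattice_weight m) * 1"
      using mult_left_mono[OF emeasure_dyadic_cube_le[of "(0, m)"], of "ennreal (2 ^ (CARD('n) + 1) * lattice_weight m)"]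
      by (subst nn_integral_cmult_indicator) (simp_all add: dyadic_vol_def)
    finally show ?thesis by (simp add: ennreal_mult' lattice_weight_nonneg flip: ennreal_power)
  qed
  have "(\<integral>\<^sup>+ x. ennreal (?h x) \<partial>lebesgue)
      \<le> (\<integral>\<^sup>+ m. 2 ^ (CARD('n) + 1) * ennreal (lattice_weight (m :: int^'n)) \<partial>count_space UNIV)"
    by (subst nn_integral_dyadic_partition[OF m, of 0]) (intro nn_integral_mono cube)
  also have "\<dots> = 2 ^ (CARD('n) + 1) * (\<integral>\<^sup>+ m. ennreal (lattice_weight (m :: int^'n)) \<partial>count_space UNIV)"
    by (intro nn_integral_cmult) auto
  also have "\<dots> < \<infinity>"
    using lattice_weight_summable[where 'n = 'n]
    by (auto simp: ennreal_mult_less_top power_less_top_ennreal)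
  finally show ?thesis .
qed

lemma integrable_bracket: "integrable lborel (\<lambda>x::real^'n. 1 / (1 + norm x) ^ (CARD('n) + 1))"
  using nn_integral_bracket_finite[where 'n = 'n]
  by (intro integrableI_bounded) (auto simp: nn_integral_completion)

lemma schwartz_cis_integrable:
  fixes h :: "real^'n \<Rightarrow> complex"
  assumes "schwartz h"
  shows "integrable lborel (\<lambda>\<xi>. cis (y \<bullet> \<xi>) * h \<xi>)"
proof -
  obtain B where B: "B \<ge> 0" "\<And>x. cmod (h x) \<le> B / (1 + norm x) ^ (CARD('n) + 1)"
    using schwartz_decay[OF assms, of "[]" "CARD('n) + 1"] by auto
  have [measurable]: "h \<in> borel_measurable borel" by (rule schwartz_borel_measurable[OF assms])
  have I: "integrable lborel (\<lambda>x::real^'n. B * (1 / (1 + norm x) ^ (CARD('n) + 1)))"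
    by (intro integrable_mult_right integrable_bracket)
  have c: "(\<lambda>\<xi>. cis (y \<bullet> \<xi>)) \<in> borel_measurable borel"
    by (intro borel_measurable_continuous_onI continuous_intros)
  show "integrable lborel (\<lambda>\<xi>. cis (y \<bullet> \<xi>) * h \<xi>)"
    using B c by (intro Bochner_Integration.integrable_bound[OF I]) (auto simp: norm_mult order_trans[OF _ abs_ge_self])
qed

text \<open>Integration by parts without Fubini: the difference quotients of the integrand in direction \<open>i\<close> have
  integral zero by translation invariance, and they converge dominatedly.\<close>

lemma fourier_integral_pderiv:
  fixes h :: "real^'n \<Rightarrow> complex"
  assumes "schwartz h"
  shows "(LINT \<xi>|lborel. cis (y \<bullet> \<xi>) * pderiv_dir i h \<xi>) = - (\<i> * y $ i) * (LINT \<xi>|lborel. cis (y \<bullet> \<xi>) * h \<xi>)"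
proof -
  define N where "N = CARD('n) + 1"
  have sm: "smooth_fun h" using assms by (simp add: schwartz_def)
  have h': "schwartz (pderiv_dir i h)" using schwartz_pderivs[OF assms, of "[i]"] by simp
  define F where "F = (\<lambda>\<xi>. cis (y \<bullet> \<xi>) * h \<xi>)"
  \<comment> \<open>\<open>F'\<close> is the derivative of \<open>F\<close> in direction
    \<open>i\<close> by the product rule. The claim amounts to its integral being zero.\<close>
  define F' where "F' = (\<lambda>\<xi>. cis (y \<bullet> \<xi>) * pderiv_dir i h \<xi> + (\<i> * y $ i) * (cis (y \<bullet> \<xi>) * h \<xi>))"
  define e where "e = (axis i 1 :: real^'n)"
  have ye: "y \<bullet> e = y $ i" by (simp add: e_def inner_axis)
  have intF: "integrable lborel F" unfolding F_def by (rule schwartz_cis_integrable[OF assms])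
  have measF' [measurable]: "F' \<in> borel_measurable borel"
    unfolding F'_def using schwartz_cis_integrable[OF assms, of y] schwartz_cis_integrable[OF h', of y]
    by (auto dest: borel_measurable_integrable)
  have [measurable]: "F \<in> borel_measurable borel" using intF by (auto dest: borel_measurable_integrable)
  have der: "((\<lambda>t. F (\<xi> + t *\<^sub>R e)) has_vector_derivative F' (\<xi> + s *\<^sub>R e)) (at s)" for \<xi> s
  proof -
    have "((\<lambda>t. cis (y \<bullet> \<xi> + t * y $ i)) has_vector_derivative \<i> * y $ i * cis (y \<bullet> \<xi> + s * y $ i)) (at s)"
    proof -
      have "((\<lambda>z. exp (\<i> * (of_real (y \<bullet> \<xi>) + z * of_real (y $ i)))) has_field_derivative
        \<i> * y $ i * exp (\<i> * (of_real (y \<bullet> \<xi>) + of_real s * of_real (y $ i)))) (at (of_real s))"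
        by (auto intro!: derivative_eq_intros)
      from has_vector_derivative_real_field[OF this] show ?thesis
        by (simp add: cis_conv_exp)
    qed
    from has_vector_derivative_mult[OF this has_vector_derivative_pderiv_dir[OF sm, of \<xi> i s]]
    show ?thesis
      unfolding F_def F'_def by (simp add: inner_add_right ye e_def[symmetric] algebra_simps)
  qed
  obtain B1 where B1: "B1 \<ge> 0" "\<And>x. cmod (h x) \<le> B1 / (1 + norm x) ^ N"
    using schwartz_decay[OF assms, of "[]" N] by auto
  obtain B2 where B2: "B2 \<ge> 0" "\<And>x. cmod (pderiv_dir i h x) \<le> B2 / (1 + norm x) ^ N"
    using schwartz_decay[OF h', of "[]" N] by auto
  define B where "B = B2 + \<bar>y $ i\<bar> * B1"
  have B: "B \<ge> 0" using B1 B2 by (simp add: B_def)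
  have F'_bound: "cmod (F' x) \<le> B / (1 + norm x) ^ N" for x
  proof -
    have "cmod (F' x) \<le> cmod (pderiv_dir i h x) + \<bar>y $ i\<bar> * cmod (h x)"
      unfolding F'_def by (rule norm_triangle_le) (simp add: norm_mult)
    also have "\<dots> \<le> B2 / (1 + norm x) ^ N + \<bar>y $ i\<bar> * (B1 / (1 + norm x) ^ N)"
      by (intro add_mono mult_left_mono B1 B2) auto
    finally show ?thesis by (simp add: B_def add_divide_distrib)
  qed
  \<comment> \<open>Step sizes of the difference quotients: they tend to 0, and being at most 1 they
    permit one majorant for all \<open>k\<close>.\<close>
  define t where "t = (\<lambda>k::nat. 1 / real (Suc k))"
  have t: "0 < t k" "t k \<le> 1" for k by (auto simp: t_def)
  define q where "q = (\<lambda>k \<xi>. (F (\<xi> + t k *\<^sub>R e) - F \<xi>) /\<^sub>R t k)"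
  have "(\<lambda>k. integral\<^sup>L lborel (q k)) \<longlonglongrightarrow> integral\<^sup>L lborel F'"
  proof (rule integral_dominated_convergence)
    show "integrable lborel (\<lambda>x::real^'n. 2 ^ N * B * (1 / (1 + norm x) ^ N))"
      unfolding N_def by (intro integrable_mult_right integrable_bracket)
    show "AE x in lborel. (\<lambda>k. q k x) \<longlonglongrightarrow> F' x"
    proof (intro AE_I2)
      fix x
      have "((\<lambda>t. F (x + t *\<^sub>R e)) has_vector_derivative F' x) (at 0)" using der[of x 0] by simp
      then have "((\<lambda>s. (F (x + s *\<^sub>R e) - F x) /\<^sub>R s) \<longlongrightarrow> F' x) (at 0)"
      proof -
        \<comment> \<open>The definition of the derivative divides the remainder by the absolute
          value of \<open>s\<close>. Taking norms removes the sign and yields convergence of the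
          usual difference quotient.\<close>
        have "((\<lambda>s. norm ((F (x + s *\<^sub>R e) - F x - s *\<^sub>R F' x) /\<^sub>R \<bar>s\<bar>)) \<longlongrightarrow> 0) (at 0)"
          using \<open>((\<lambda>t. F (x + t *\<^sub>R e)) has_vector_derivative F' x) (at 0)\<close>
          by (intro tendsto_norm_zero) (simp add: has_vector_derivative_def has_derivative_def)
        moreover have "norm ((F (x + s *\<^sub>R e) - F x - s *\<^sub>R F' x) /\<^sub>R \<bar>s\<bar>)
            = norm ((F (x + s *\<^sub>R e) - F x) /\<^sub>R s - F' x)" if "s \<noteq> 0" for s
        proof -
          have "(F (x + s *\<^sub>R e) - F x) /\<^sub>R s - F' x = (F (x + s *\<^sub>R e) - F x - s *\<^sub>R F' x) /\<^sub>R s"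
            using that by (simp add: scaleR_diff_right)
          then show ?thesis by simp
        qed
        ultimately have "((\<lambda>s. norm ((F (x + s *\<^sub>R e) - F x) /\<^sub>R s - F' x)) \<longlongrightarrow> 0) (at 0)"
          by (elim Lim_transform_eventually) (simp add: eventually_at_filter)
        then show ?thesis
          by (simp add: tendsto_norm_zero_iff LIM_zero_iff)
      qed
      moreover have "filterlim t (at 0) sequentially"
        unfolding filterlim_at using t LIMSEQ_inverse_real_of_nat
        by (auto simp: t_def inverse_eq_divide)
      ultimately show "(\<lambda>k. q k x) \<longlonglongrightarrow> F' x"
        unfolding q_def by (rule filterlim_compose)
    qed
    show "AE x in lborel. norm (q k x) \<le> 2 ^ N * B * (1 / (1 + norm x) ^ N)" for k
    proof (intro AE_I2)
      fix x
      have "norm (F (x + t k *\<^sub>R e) - F (x + 0 *\<^sub>R e)) \<le> (2 ^ N * B * (1 / (1 + norm x) ^ N)) * \<bar>t k\<bar>"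
      proof (rule norm_increment_le_vector_derivative_bound[OF der])
        fix s assume "s \<in> closed_segment 0 (t k)"
        then have s: "0 \<le> s" "s \<le> 1" using t[of k] by (auto simp: closed_segment_eq_real_ivl split: if_splits)
        have "norm x \<le> norm (x + s *\<^sub>R e) + norm (s *\<^sub>R e)"
          using norm_triangle_ineq4[of "x + s *\<^sub>R e" "s *\<^sub>R e"] by simp
        moreover have "norm (s *\<^sub>R e) \<le> 1" using s by (simp add: e_def)
        \<comment> \<open>A shift of length at most 1 changes \<open>1 + norm x\<close> by at most a
          factor 2; this is the source of the \<open>2 ^ N\<close> in the majorant.\<close>
        ultimately have "1 + norm x \<le> 2 * (1 + norm (x + s *\<^sub>R e))"
          using norm_ge_zero[of "x + s *\<^sub>R e"] by argo
        then have "(1 + norm x) ^ N \<le> 2 ^ N * (1 + norm (x + s *\<^sub>R e)) ^ N"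
          unfolding power_mult_distrib[symmetric] by (intro power_mono) auto
        then have "1 / (1 + norm (x + s *\<^sub>R e)) ^ N \<le> 2 ^ N / (1 + norm x) ^ N"
          by (intro mult_imp_div_pos_le) (auto simp: add_pos_nonneg divide_simps mult.commute)
        then have "B * (1 / (1 + norm (x + s *\<^sub>R e)) ^ N) \<le> B * (2 ^ N / (1 + norm x) ^ N)"
          using B by (rule mult_left_mono)
        then show "cmod (F' (x + s *\<^sub>R e)) \<le> 2 ^ N * B * (1 / (1 + norm x) ^ N)"
          using F'_bound[of "x + s *\<^sub>R e"] by (simp add: mult.commute)
      qed
      moreover have "norm (q k x) = norm (F (x + t k *\<^sub>R e) - F x) / t k"
        using t[of k] by (simp add: q_def divide_inverse mult.commute)
      ultimately show "norm (q k x) \<le> 2 ^ N * B * (1 / (1 + norm x) ^ N)"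
        using t[of k] by (simp only: pos_divide_le_eq) simp
    qed
  qed (auto simp: q_def)
  \<comment> \<open>By translation invariance both terms of the difference quotient have the same
    integral.\<close>
  moreover have "integral\<^sup>L lborel (q k) = 0" for k
  proof -
    have *: "integrable lborel (\<lambda>x. F (x + t k *\<^sub>R e))" "integral\<^sup>L lborel (\<lambda>x. F (x + t k *\<^sub>R e)) = integral\<^sup>L lborel F"
      using intF integrable_distr_eq[of "(+) (t k *\<^sub>R e)" lborel borel F] integral_distr[of "(+) (t k *\<^sub>R e)" lborel borel F]
      by (auto simp: lborel_distr_plus add.commute)
    show ?thesis unfolding q_def using * intF by simp
  qed
  ultimately have "integral\<^sup>L lborel F' = 0" by (simp add: LIMSEQ_const_iff)
  moreover have "integral\<^sup>L lborel F' = (LINT \<xi>|lborel. cis (y \<bullet> \<xi>) * pderiv_dir i h \<xi>) + (\<i> * y $ i) * (LINT \<xi>|lborel. cis (y \<bullet> \<xi>) * h \<xi>)"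
    unfolding F'_def using schwartz_cis_integrable[OF assms, of y] schwartz_cis_integrable[OF h', of y] by simp
  ultimately show ?thesis by (simp add: eq_neg_iff_add_eq_0)
qed

text \<open>Integrating by parts \<open>k\<close> times in direction \<open>i\<close> bounds the
  \<open>k\<close>-th power of the \<open>i\<close>-th coordinate of \<open>y\<close> times the
  transform by the L1 norm \<open>J i k\<close> of a derivative. Decay in \<open>norm y\<close>
  follows by choosing, for each \<open>y\<close>, the coordinate of largest modulus.\<close>

lemma fourier_integral_decay:
  fixes h :: "real^'n \<Rightarrow> complex"
  assumes "schwartz h"
  obtains C where "C \<ge> 0" "\<And>y. cmod (LINT \<xi>|lborel. cis (y \<bullet> \<xi>) * h \<xi>) \<le> C / (1 + norm y) ^ N"
proof -
  let ?ft = "\<lambda>h y. LINT \<xi>|lborel. cis (y \<bullet> \<xi>) * h \<xi>"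
  define J where "J = (\<lambda>i k. LINT \<xi>|lborel. cmod (pderivs (replicate k i) h \<xi>))"
  have ft: "?ft (pderivs (replicate k i) h) y = (- (\<i> * y $ i)) ^ k * ?ft h y" for k i y
  proof (induction k)
    case (Suc k)
    then show ?case
      using fourier_integral_pderiv[OF schwartz_pderivs[OF assms], of y i "replicate k i"] by simp
  qed simp
  have J: "\<bar>y $ i\<bar> ^ k * cmod (?ft h y) \<le> J i k" for y i k
  proof -
    have "\<bar>y $ i\<bar> ^ k * cmod (?ft h y) = cmod (?ft (pderivs (replicate k i) h) y)"
      unfolding ft by (simp add: norm_mult norm_power)
    also have "\<dots> \<le> J i k"
      unfolding J_def by (rule order_trans[OF integral_norm_bound]) (simp add: norm_mult)
    finally show ?thesis .
  qed
  have Jnn: "J i k \<ge> 0" for i k unfolding J_def by (intro integral_nonneg_AE) auto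
  define D where "D = real CARD('n) + 1"
  define C where "C = D ^ N * ((\<Sum>i\<in>UNIV. J i 0) + (\<Sum>i\<in>UNIV. J i N))"
  have "C \<ge> 0" unfolding C_def D_def by (intro mult_nonneg_nonneg add_nonneg_nonneg sum_nonneg Jnn) auto
  moreover have "cmod (?ft h y) \<le> C / (1 + norm y) ^ N" for y
  proof -
    obtain i where i: "\<And>k. \<bar>y $ k\<bar> \<le> \<bar>y $ i\<bar>"
    proof -
      have "Max (range (\<lambda>k. \<bar>y $ k\<bar>)) \<in> range (\<lambda>k. \<bar>y $ k\<bar>)" by (intro Max_in) auto
      then obtain i where "Max (range (\<lambda>k. \<bar>y $ k\<bar>)) = \<bar>y $ i\<bar>" by (rule imageE)
      then have "\<bar>y $ k\<bar> \<le> \<bar>y $ i\<bar>" for k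
        using Max_ge[of "range (\<lambda>k. \<bar>y $ k\<bar>)" "\<bar>y $ k\<bar>"] by simp
      then show ?thesis using that by blast
    qed
    have "norm y \<le> (\<Sum>k\<in>UNIV. \<bar>y $ k\<bar>)" by (rule norm_le_l1_cart)
    also have "\<dots> \<le> real CARD('n) * \<bar>y $ i\<bar>" using sum_bounded_above[of UNIV "\<lambda>k. \<bar>y $ k\<bar>"] i by simp
    \<comment> \<open>The maximum with 1 covers small \<open>y\<close>; its \<open>N\<close>-th
      power is at most \<open>1 + \<bar>y $ i\<bar> ^ N\<close>, so derivatives of orders 0 and
      \<open>N\<close> suffice.\<close>
    finally have "1 + norm y \<le> D * max 1 \<bar>y $ i\<bar>"
    proof -
      assume "norm y \<le> real CARD('n) * \<bar>y $ i\<bar>"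
      also have "\<dots> \<le> real CARD('n) * max 1 \<bar>y $ i\<bar>" by (intro mult_left_mono) auto
      finally show ?thesis by (simp add: D_def distrib_right)
    qed
    then have "(1 + norm y) ^ N \<le> D ^ N * (max 1 \<bar>y $ i\<bar>) ^ N"
      unfolding power_mult_distrib[symmetric] by (intro power_mono) auto
    also have "(max 1 \<bar>y $ i\<bar>) ^ N \<le> 1 + \<bar>y $ i\<bar> ^ N" by (simp add: max_def)
    finally have "(1 + norm y) ^ N \<le> D ^ N * (1 + \<bar>y $ i\<bar> ^ N)" by (simp add: D_def)
    then have "(1 + norm y) ^ N * cmod (?ft h y) \<le> D ^ N * (1 + \<bar>y $ i\<bar> ^ N) * cmod (?ft h y)"
      by (intro mult_right_mono) auto
    also have "\<dots> = D ^ N * (\<bar>y $ i\<bar> ^ 0 * cmod (?ft h y) + \<bar>y $ i\<bar> ^ N * cmod (?ft h y))"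
      by (simp add: algebra_simps)
    also have "\<dots> \<le> D ^ N * (J i 0 + J i N)"
      by (intro mult_left_mono add_mono J) (simp add: D_def)
    also have "\<dots> \<le> C"
      unfolding C_def by (intro mult_left_mono add_mono member_le_sum) (auto simp: Jnn D_def)
    finally show ?thesis
      by (subst pos_le_divide_eq) (auto simp: add_pos_nonneg mult.commute)
  qed
  ultimately show ?thesis using that by blast
qed

lemma fourier_integral_scaleR:
  fixes h :: "real^'n \<Rightarrow> complex"
  assumes "schwartz h" "0 < a"
  shows "(LINT \<xi>|lborel. cis (y \<bullet> \<xi>) * h (a *\<^sub>R \<xi>)) = of_real ((1 / a) ^ CARD('n)) * (LINT \<xi>|lborel. cis ((y /\<^sub>R a) \<bullet> \<xi>) * h \<xi>)"
proof -
  let ?F = "\<lambda>\<xi>. cis (y \<bullet> \<xi>) * h (a *\<^sub>R \<xi>)"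
  have [measurable]: "?F \<in> borel_measurable borel"
    using borel_measurable_integrable[OF schwartz_cis_integrable[OF schwartz_scaleR[OF assms], of y]] by simp
  have "(LINT \<xi>|lborel. ?F \<xi>) = (LINT \<xi>|density (distr lborel borel (\<lambda>x. 0 + (1/a) *\<^sub>R x)) (\<lambda>_. \<bar>1/a\<bar> ^ DIM(real^'n)). ?F \<xi>)"
    using assms by (subst (1) lborel_affine[of "1/a" 0]) auto
  also have "\<dots> = (LINT \<xi>|lborel. (1/a) ^ CARD('n) *\<^sub>R ?F ((1/a) *\<^sub>R \<xi>))"
    using assms by (simp add: integral_density integral_distr)
  also have "\<dots> = of_real ((1 / a) ^ CARD('n)) * (LINT \<xi>|lborel. cis ((y /\<^sub>R a) \<bullet> \<xi>) * h \<xi>)"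
    using assms by (simp add: scaleR_conv_of_real[where 'a = complex] divide_inverse)
  finally show ?thesis .
qed

text \<open>For positive \<open>j\<close> the symbol is a difference of two dilates of
  \<open>\<phi>0\<close>, and for \<open>j = 0\<close> it is \<open>\<phi>0\<close> itself. The
  kernel is thus built from rescaled copies of one rapidly decaying transform, at the scales
  \<open>2 ^ j\<close> and \<open>2 ^ j / 2\<close>.\<close>

lemma LP_kernel_decay:
  fixes \<phi>0 :: "real^'n \<Rightarrow> real"
  assumes "LP_generator \<phi>0"
  obtains C where "C \<ge> 0" "\<And>j y. cmod (LP_kernel \<phi>0 j y) \<le> C * (2 ^ j) ^ CARD('n) / (1 + 2 ^ j * norm y) ^ N"
proof -
  let ?h = "\<lambda>\<xi>. complex_of_real (\<phi>0 \<xi>)"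
  have sch: "schwartz ?h" using assms by (simp add: LP_generator_def)
  obtain C where C: "C \<ge> 0" "\<And>y. cmod (LINT \<xi>|lborel. cis (y \<bullet> \<xi>) * ?h \<xi>) \<le> C / (1 + norm y) ^ N"
    using fourier_integral_decay[OF sch, of N] by blast
  define G where "G = (\<lambda>a y. LINT \<xi>|lborel. cis (y \<bullet> \<xi>) * ?h (a *\<^sub>R \<xi>))"
  have G: "cmod (G (1 / a) y) \<le> C * a ^ CARD('n) / (1 + a * norm y) ^ N" if "a > 0" for a y
  proof -
    have "cmod (G (1 / a) y) = a ^ CARD('n) * cmod (LINT \<xi>|lborel. cis ((a *\<^sub>R y) \<bullet> \<xi>) * ?h \<xi>)"
      unfolding G_def using fourier_integral_scaleR[OF sch, of "1 / a" y] that by (simp add: norm_mult norm_power)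
    also have "\<dots> \<le> a ^ CARD('n) * (C / (1 + norm (a *\<^sub>R y)) ^ N)"
      using that by (intro mult_left_mono C) auto
    finally show ?thesis using that by (simp add: mult.commute)
  qed
  \<comment> \<open>The coarser of the two dilates is rewritten at scale \<open>2 ^ j\<close>:
    halving \<open>a\<close> at most halves \<open>1 + a * norm y\<close>, which costs the factor
    \<open>2 ^ N\<close>.\<close>
  have G': "cmod (G (1 / (2 ^ j / 2)) y) \<le> 2 ^ N * (C * (2 ^ j) ^ CARD('n) / (1 + 2 ^ j * norm y) ^ N)" for j y
  proof -
    define a where "a = (2::real) ^ j"
    have a: "a > 0" by (simp add: a_def)
    have "cmod (G (1 / (a / 2)) y) \<le> C * (a / 2) ^ CARD('n) / (1 + a / 2 * norm y) ^ N"
      using a by (intro G) simp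
    also have "\<dots> \<le> C * a ^ CARD('n) / ((1 + a * norm y) / 2) ^ N"
      using a C(1) by (intro frac_le mult_left_mono power_mono zero_less_power mult_nonneg_nonneg) (auto simp: add_pos_nonneg)
    also have "\<dots> = 2 ^ N * (C * a ^ CARD('n) / (1 + a * norm y) ^ N)"
      by (simp add: power_divide)
    finally show ?thesis by (simp add: a_def)
  qed
  define c where "c = (2 * pi) powr (- real CARD('n))"
  have c: "c \<ge> 0" by (simp add: c_def)
  have intg: "integrable lborel (\<lambda>\<xi>. cis (y \<bullet> \<xi>) * ?h (a *\<^sub>R \<xi>))" if "a > 0" for a y
    by (rule schwartz_cis_integrable[OF schwartz_scaleR[OF sch that]])
  have LP: "LP_kernel \<phi>0 j y = of_real c * (if j = 0 then G (1 / 2 ^ j) y else G (1 / 2 ^ j) y - G (1 / (2 ^ j / 2)) y)" for j y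
  proof -
    have e: "2 powr (- real j) = 1 / 2 ^ j" "2 powr (1 - real j) = 1 / (2 ^ j / 2)"
      by (simp_all add: powr_minus_divide powr_diff powr_realpow)
    have i1: "integrable lborel (\<lambda>\<xi>. cis (y \<bullet> \<xi>) * ?h ((1 / 2 ^ j) *\<^sub>R \<xi>))"
      and i2: "integrable lborel (\<lambda>\<xi>. cis (y \<bullet> \<xi>) * ?h ((1 / (2 ^ j / 2)) *\<^sub>R \<xi>))"
      by (rule intg, simp)+
    have S: "(\<lambda>\<xi>. cis (y \<bullet> \<xi>) * complex_of_real (LP_symbol \<phi>0 j \<xi>)) =
       (\<lambda>\<xi>. if j = 0 then cis (y \<bullet> \<xi>) * ?h ((1 / 2 ^ j) *\<^sub>R \<xi>) else cis (y \<bullet> \<xi>) * ?h ((1 / 2 ^ j) *\<^sub>R \<xi>) - cis (y \<bullet> \<xi>) * ?h ((1 / (2 ^ j / 2)) *\<^sub>R \<xi>))"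
      unfolding LP_symbol_def e by (cases "j = 0") (simp_all add: right_diff_distrib)
    have "(LINT \<xi>|lborel. cis (y \<bullet> \<xi>) * complex_of_real (LP_symbol \<phi>0 j \<xi>)) = (if j = 0 then G (1 / 2 ^ j) y else G (1 / 2 ^ j) y - G (1 / (2 ^ j / 2)) y)"
      unfolding S G_def using Bochner_Integration.integral_diff[OF i1 i2] by (cases "j = 0") simp_all
    moreover have "(\<lambda>\<xi>. cis (y \<bullet> \<xi>) * complex_of_real (LP_symbol \<phi>0 j \<xi>)) \<in> borel_measurable lborel"
      unfolding S using borel_measurable_integrable[OF i1] borel_measurable_integrable[OF i2]
      by (cases "j = 0") simp_all
    ultimately show ?thesis
      unfolding LP_kernel_def by (simp add: integral_completion c_def)
  qed
  have "cmod (LP_kernel \<phi>0 j y) \<le> c * (1 + 2 ^ N) * C * (2 ^ j) ^ CARD('n) / (1 + 2 ^ j * norm y) ^ N" for j y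
  proof -
    let ?E = "C * (2 ^ j) ^ CARD('n) / (1 + 2 ^ j * norm y) ^ N"
    have "?E \<ge> 0" using C by auto
    have "cmod (LP_kernel \<phi>0 j y) \<le> c * (cmod (G (1 / 2 ^ j) y) + cmod (G (1 / (2 ^ j / 2)) y))"
    proof -
      have "cmod (if j = 0 then G (1 / 2 ^ j) y else G (1 / 2 ^ j) y - G (1 / (2 ^ j / 2)) y)
          \<le> cmod (G (1 / 2 ^ j) y) + cmod (G (1 / (2 ^ j / 2)) y)"
        by (cases "j = 0") (simp_all only: if_True if_False norm_triangle_ineq4 simp_thms le_add_same_cancel1 norm_ge_zero)
      then show ?thesis
        unfolding LP norm_mult using c by (simp only: norm_of_real abs_of_nonneg) (rule mult_left_mono)
    qed
    also have "\<dots> \<le> c * (?E + 2 ^ N * ?E)"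
      using c by (intro mult_left_mono add_mono G G') auto
    finally show ?thesis by (simp add: algebra_simps add_divide_distrib)
  qed
  moreover have "c * (1 + 2 ^ N) * C \<ge> 0" using c C by simp
  ultimately show ?thesis using that by blast
qed

section \<open>The embedding\<close>

lemma nn_integral_lattice_translate:
  "(\<integral>\<^sup>+ m'. f (m - m') \<partial>count_space UNIV) = (\<integral>\<^sup>+ m'. f m' \<partial>count_space (UNIV :: (int^'n) set))"
  by (rule nn_integral_bij_count_space) (rule bij_betw_byWitness[where f' = "\<lambda>x. m - x"], auto)

lemma nn_integral_count_space_swap:
  fixes f :: "'a::countable \<Rightarrow> 'b \<Rightarrow> ennreal"
  shows "(\<integral>\<^sup>+ x. \<integral>\<^sup>+ y. f y x \<partial>count_space UNIV \<partial>count_space UNIV)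
    = (\<integral>\<^sup>+ y. \<integral>\<^sup>+ x. f y x \<partial>count_space UNIV \<partial>count_space UNIV)"
  by (rule nn_integral_count_space_nn_integral) auto

text \<open>Cauchy-Schwarz after splitting the weight into two square roots. By reflection and
  translation the first factor is the total mass of the weight for every \<open>m\<close>.\<close>

lemma lattice_convolution_square_le:
  fixes c :: "int^'n \<Rightarrow> ennreal"
  shows "(\<integral>\<^sup>+ m'. ennreal (lattice_weight (m - m')) * c m' \<partial>count_space UNIV)\<^sup>2
    \<le> (\<integral>\<^sup>+ m'. ennreal (lattice_weight (m' :: int^'n)) \<partial>count_space UNIV)
      * (\<integral>\<^sup>+ m'. ennreal (lattice_weight (m - m')) * (c m')\<^sup>2 \<partial>count_space UNIV)"
proof -
  define r where "r = (\<lambda>m'. ennreal (sqrt (lattice_weight (m - m'))))"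
  have r: "r m' * r m' = ennreal (lattice_weight (m - m'))" for m'
    by (simp add: r_def lattice_weight_nonneg flip: ennreal_mult)
  have "(\<integral>\<^sup>+ m'. r m' * (r m' * c m') \<partial>count_space UNIV)\<^sup>2
      \<le> (\<integral>\<^sup>+ m'. (r m')\<^sup>2 \<partial>count_space UNIV) * (\<integral>\<^sup>+ m'. (r m' * c m')\<^sup>2 \<partial>count_space UNIV)"
    by (rule Cauchy_Schwarz_nn_integral) auto
  moreover have "r m' * (r m' * c m') = ennreal (lattice_weight (m - m')) * c m'" for m'
    by (simp only: mult.assoc[symmetric] r)
  moreover have "(r m')\<^sup>2 = ennreal (lattice_weight (m - m'))" for m'
    by (simp only: power2_eq_square r)
  ultimately show ?thesis
    using nn_integral_lattice_translate[of "\<lambda>m'. ennreal (lattice_weight m')" m]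
    by (simp only: power_mult_distrib)
qed

text \<open>The integral of a nonintegrable function is 0 by convention, so the bound is
  unconditional. This lets the L2 estimate for \<open>LP_op\<close> be stated for all measurable
  functions.\<close>

lemma norm_integral_le_nn_integral:
  fixes f :: "'a \<Rightarrow> 'b::{banach, second_countable_topology}"
  shows "ennreal (norm (integral\<^sup>L M f)) \<le> (\<integral>\<^sup>+ x. ennreal (norm (f x)) \<partial>M)"
  by (cases "integrable M f") (auto intro: integral_norm_bound_ennreal simp: not_integrable_integral_eq)

text \<open>A Schur test at scale \<open>2 ^ - j\<close>: on each dyadic cube of generation \<open>j\<close> the kernel is constant up to
  a bounded factor, so \<open>\<Delta>\<^sub>j\<close> acts like convolution with a summable weight on the lattice.\<close>

lemma LP_op_L2_bound:
  fixes \<phi>0 :: "real^'n \<Rightarrow> real"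
  assumes "LP_generator \<phi>0"
  obtains C where "C \<ge> 0" "\<And>j f. f \<in> borel_measurable lebesgue \<Longrightarrow>
    L2_sq (LP_op \<phi>0 j (dist_of f)) \<le> ennreal (C * (2 ^ j) ^ CARD('n)) *
      (\<integral>\<^sup>+ m. (\<integral>\<^sup>+ x\<in>dyadic_cube (int j, m). ennreal (cmod (f x)) \<partial>lebesgue)\<^sup>2 \<partial>count_space UNIV)"
proof -
  define N where "N = CARD('n) + 1"
  obtain C0 where C0: "C0 \<ge> 0"
    "\<And>j y. cmod (LP_kernel \<phi>0 j y) \<le> C0 * (2 ^ j) ^ CARD('n) / (1 + 2 ^ j * norm y) ^ N"
    using LP_kernel_decay[OF assms] by blast
  define W where "W = (\<integral>\<^sup>+ m. ennreal (lattice_weight (m :: int^'n)) \<partial>count_space UNIV)"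
  define w where "w = enn2real W"
  have W: "W = ennreal w" "w \<ge> 0"
    using lattice_weight_summable[where 'n = 'n] by (simp_all add: w_def W_def)
  \<comment> \<open>\<open>C0 * 2 ^ N\<close> compares the kernel with the weight. Of the two
    factors \<open>w\<close> in the square, one comes from Cauchy-Schwarz and the other from summing
    over the output cube.\<close>
  define C where "C = (C0 * 2 ^ N * w)\<^sup>2"
  have "L2_sq (LP_op \<phi>0 j (dist_of f)) \<le> ennreal (C * (2 ^ j) ^ CARD('n)) *
      (\<integral>\<^sup>+ m. (\<integral>\<^sup>+ x\<in>dyadic_cube (int j, m). ennreal (cmod (f x)) \<partial>lebesgue)\<^sup>2 \<partial>count_space UNIV)"
    if [measurable]: "f \<in> borel_measurable lebesgue" for j and f :: "real^'n \<Rightarrow> complex"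
  proof -
    define c where "c = (\<lambda>m. \<integral>\<^sup>+ x\<in>dyadic_cube (int j, m). ennreal (cmod (f x)) \<partial>lebesgue)"
    define V where "V = ((2::real) ^ j) ^ CARD('n)"
    have V: "V > 0" by (simp add: V_def)
    define D where "D = C0 * V * 2 ^ N"
    have D: "D \<ge> 0" using C0 V by (simp add: D_def)
    \<comment> \<open>\<open>H m\<close> will bound the squared modulus of \<open>LP_op\<close> at
      every point of the cube with index \<open>m\<close>.\<close>
    define H where "H = (\<lambda>m. (ennreal D)\<^sup>2 * (W * (\<integral>\<^sup>+ m'. ennreal (lattice_weight (m - m')) * (c m')\<^sup>2 \<partial>count_space UNIV)))"
    have ptw: "(ennreal (cmod (LP_op \<phi>0 j (dist_of f) x)))\<^sup>2 \<le> H m" if x: "x \<in> dyadic_cube (int j, m)" for x m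
    proof -
      have K: "cmod (LP_kernel \<phi>0 j (x - y)) \<le> D * lattice_weight (m - m')" if y: "y \<in> dyadic_cube (int j, m')" for y m'
      proof -
        have "cmod (LP_kernel \<phi>0 j (x - y)) \<le> C0 * V * (1 / (1 + 2 ^ j * norm (x - y)) ^ N)"
          using C0(2)[of j "x - y"] by (simp add: V_def)
        also have "1 / (1 + 2 ^ j * norm (x - y)) ^ N \<le> 2 ^ N * lattice_weight (m - m')"
          using inverse_bracket_le_lattice_weight[OF x y] by (simp add: N_def powr_realpow)
        finally show ?thesis using C0 V by (simp add: D_def mult_left_mono mult.assoc)
      qed
      have "ennreal (cmod (LP_op \<phi>0 j (dist_of f) x))
          \<le> (\<integral>\<^sup>+ y. ennreal (cmod (f y * LP_kernel \<phi>0 j (x - y))) \<partial>lebesgue)"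
        unfolding LP_op_def dist_of_def by (rule norm_integral_le_nn_integral)
      also have "\<dots> \<le> (\<integral>\<^sup>+ y. (\<integral>\<^sup>+ m'. ennreal (D * lattice_weight (m - m')) *
          (ennreal (cmod (f y)) * indicator (dyadic_cube (int j, m')) y) \<partial>count_space UNIV) \<partial>lebesgue)"
      proof (intro nn_integral_mono)
        fix y :: "real^'n"
        let ?m = "\<chi> i. \<lfloor>2 powr of_int (int j) * y $ i\<rfloor>"
        have "ennreal (cmod (f y * LP_kernel \<phi>0 j (x - y))) \<le> ennreal (D * lattice_weight (m - ?m)) * ennreal (cmod (f y))"
          using K[of y ?m] by (auto simp: norm_mult mem_dyadic_cube_iff mult.commute[of "cmod (f y)"] D lattice_weight_nonneg
            simp flip: ennreal_mult intro!: ennreal_leI mult_right_mono)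
        then show "ennreal (cmod (f y * LP_kernel \<phi>0 j (x - y))) \<le> (\<integral>\<^sup>+ m'. ennreal (D * lattice_weight (m - m')) *
          (ennreal (cmod (f y)) * indicator (dyadic_cube (int j, m')) y) \<partial>count_space UNIV)"
          unfolding mult.assoc[symmetric] by (subst lattice_sum_indicator_dyadic_cube)
      qed
      also have "\<dots> = (\<integral>\<^sup>+ m'. (\<integral>\<^sup>+ y. ennreal (D * lattice_weight (m - m')) *
          (ennreal (cmod (f y)) * indicator (dyadic_cube (int j, m')) y) \<partial>lebesgue) \<partial>count_space UNIV)"
        by (intro nn_integral_count_space_nn_integral) auto
      also have "\<dots> = (\<integral>\<^sup>+ m'. ennreal (D * lattice_weight (m - m')) * c m' \<partial>count_space UNIV)"
        unfolding c_def by (intro nn_integral_cong nn_integral_cmult) measurable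
      also have "\<dots> = ennreal D * (\<integral>\<^sup>+ m'. ennreal (lattice_weight (m - m')) * c m' \<partial>count_space UNIV)"
        by (subst nn_integral_cmult[symmetric]) (auto simp: D lattice_weight_nonneg ennreal_mult mult.assoc)
      finally have "(ennreal (cmod (LP_op \<phi>0 j (dist_of f) x)))\<^sup>2
          \<le> (ennreal D * (\<integral>\<^sup>+ m'. ennreal (lattice_weight (m - m')) * c m' \<partial>count_space UNIV))\<^sup>2"
        by (intro power_mono) auto
      also have "\<dots> \<le> H m"
        unfolding H_def W_def power_mult_distrib by (intro mult_left_mono lattice_convolution_square_le) auto
      finally show ?thesis .
    qed
    have "L2_sq (LP_op \<phi>0 j (dist_of f)) \<le> (\<integral>\<^sup>+ x. (\<integral>\<^sup>+ m. H m * indicator (dyadic_cube (int j, m)) x \<partial>count_space UNIV) \<partial>lebesgue)"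
      unfolding L2_sq_def
    proof (intro nn_integral_mono)
      fix x :: "real^'n"
      show "ennreal ((cmod (LP_op \<phi>0 j (dist_of f) x))\<^sup>2)
          \<le> (\<integral>\<^sup>+ m. H m * indicator (dyadic_cube (int j, m)) x \<partial>count_space UNIV)"
        by (subst lattice_sum_indicator_dyadic_cube, subst ennreal_power[symmetric])
          (auto intro!: ptw simp: mem_dyadic_cube_iff)
    qed
    also have "\<dots> = (\<integral>\<^sup>+ m. (\<integral>\<^sup>+ x. H m * indicator (dyadic_cube (int j, m)) x \<partial>lebesgue) \<partial>count_space UNIV)"
      by (intro nn_integral_count_space_nn_integral) auto
    also have "\<dots> \<le> (\<integral>\<^sup>+ m. H m * ennreal (1 / V) \<partial>count_space UNIV)"
    proof (intro nn_integral_mono)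
      fix m :: "int^'n"
      have "dyadic_vol (int j, m) = 1 / V"
        by (simp add: dyadic_vol_def V_def powr_minus_divide powr_realpow power_one_over)
      then show "(\<integral>\<^sup>+ x. H m * indicator (dyadic_cube (int j, m)) x \<partial>lebesgue) \<le> H m * ennreal (1 / V)"
        using emeasure_dyadic_cube_le[of "(int j, m)"]
        by (subst nn_integral_cmult_indicator) (auto intro: mult_left_mono)
    qed
    also have "\<dots> = (\<integral>\<^sup>+ m. H m \<partial>count_space UNIV) * ennreal (1 / V)"
      by (intro nn_integral_multc) auto
    also have "(\<integral>\<^sup>+ m. H m \<partial>count_space UNIV) = (ennreal D)\<^sup>2 * (W * (\<integral>\<^sup>+ m. \<integral>\<^sup>+ m'. ennreal (lattice_weight (m - m')) * (c m')\<^sup>2 \<partial>count_space UNIV \<partial>count_space UNIV))"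
      unfolding H_def by (subst nn_integral_cmult, simp)+ simp
    \<comment> \<open>Once the sums are exchanged, the inner one only involves the weight and gives
      the second factor \<open>W\<close>.\<close>
    also have "(\<integral>\<^sup>+ m. \<integral>\<^sup>+ m'. ennreal (lattice_weight (m - m')) * (c m')\<^sup>2 \<partial>count_space UNIV \<partial>count_space UNIV)
        = (\<integral>\<^sup>+ m'. \<integral>\<^sup>+ m. ennreal (lattice_weight (m - m')) * (c m')\<^sup>2 \<partial>count_space UNIV \<partial>count_space UNIV)"
      by (rule nn_integral_count_space_swap)
    also have "\<dots> = (\<integral>\<^sup>+ m'. W * (c m')\<^sup>2 \<partial>count_space UNIV)"
    proof (intro nn_integral_cong)
      fix m' :: "int^'n"
      have "(\<integral>\<^sup>+ m. ennreal (lattice_weight (m - m')) \<partial>count_space UNIV) = W"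
        unfolding W_def lattice_weight_minus_commute[of _ m']
        by (rule nn_integral_lattice_translate[of "\<lambda>m. ennreal (lattice_weight m)"])
      then show "(\<integral>\<^sup>+ m. ennreal (lattice_weight (m - m')) * (c m')\<^sup>2 \<partial>count_space UNIV) = W * (c m')\<^sup>2"
        by (simp add: nn_integral_multc)
    qed
    also have "\<dots> = W * (\<integral>\<^sup>+ m'. (c m')\<^sup>2 \<partial>count_space UNIV)"
      by (intro nn_integral_cmult) auto
    finally have "L2_sq (LP_op \<phi>0 j (dist_of f))
        \<le> ((ennreal D)\<^sup>2 * W * W * ennreal (1 / V)) * (\<integral>\<^sup>+ m'. (c m')\<^sup>2 \<partial>count_space UNIV)"
      by (simp add: ac_simps)
    \<comment> \<open>\<open>D\<^sup>2\<close> contains \<open>V\<^sup>2\<close> and the volume of a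
      cube removes one \<open>V\<close>, leaving the factor \<open>V\<close>, which is
      \<open>2 ^ (j n)\<close>.\<close>
    also have "(ennreal D)\<^sup>2 * W * W * ennreal (1 / V) = ennreal (C * V)"
    proof -
      have "(ennreal D)\<^sup>2 * W * W * ennreal (1 / V) = ennreal (D\<^sup>2 * w * w * (1 / V))"
        using D V W by (simp add: ennreal_mult[symmetric] ennreal_power)
      also have "D\<^sup>2 * w * w * (1 / V) = C * V"
        using V by (simp add: D_def C_def power2_eq_square field_simps)
      finally show ?thesis .
    qed
    finally show ?thesis unfolding c_def V_def .
  qed
  moreover have "C \<ge> 0" by (simp add: C_def)
  ultimately show ?thesis using that by blast
qed

text \<open>Uniformly bounded integrals over unit cubes make the integral of
  \<open>cmod (f x)\<close> against a bracket of order \<open>n + 1\<close> finite, by summability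
  of the lattice weight. The seminorm of that order then controls the pairing with any Schwartz
  function.\<close>

lemma
  fixes f :: "real^'n \<Rightarrow> complex"
  assumes [measurable]: "f \<in> borel_measurable lebesgue"
    and A: "\<And>m. (\<integral>\<^sup>+ x\<in>dyadic_cube (0, m). ennreal (cmod (f x)) \<partial>lebesgue) \<le> ennreal A"
  shows schwartz_product_integrable: "schwartz \<phi> \<Longrightarrow> integrable lebesgue (\<lambda>x. f x * \<phi> x)"
    and tempered_dist_of: "tempered (dist_of f)"
proof -
  define N where "N = CARD('n) + 1"
  let ?h = "\<lambda>x::real^'n. 1 / (1 + norm x) ^ N"
  have [measurable]: "(\<lambda>x. ennreal (?h x)) \<in> borel_measurable lebesgue"
    by (intro measurable_completion) measurable
  define W where "W = (\<integral>\<^sup>+ x. ennreal (?h x) * ennreal (cmod (f x)) \<partial>lebesgue)"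
  have "W = (\<integral>\<^sup>+ m. (\<integral>\<^sup>+ x\<in>dyadic_cube (0, m). ennreal (?h x) * ennreal (cmod (f x)) \<partial>lebesgue) \<partial>count_space UNIV)"
    unfolding W_def by (rule nn_integral_dyadic_partition) measurable
  also have "\<dots> \<le> (\<integral>\<^sup>+ m. ennreal (2 ^ N * lattice_weight (m :: int^'n)) * ennreal A \<partial>count_space UNIV)"
  proof (intro nn_integral_mono)
    fix m :: "int^'n"
    have "0 \<in> dyadic_cube (0, 0 :: int^'n)" by (auto simp: dyadic_cube_def)
    then have h: "?h x \<le> 2 ^ N * lattice_weight m" if "x \<in> dyadic_cube (0, m)" for x
      using inverse_bracket_le_lattice_weight[OF that] unfolding N_def by fastforce
    have "(\<integral>\<^sup>+ x\<in>dyadic_cube (0, m). ennreal (?h x) * ennreal (cmod (f x)) \<partial>lebesgue)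
      \<le> (\<integral>\<^sup>+ x. ennreal (2 ^ N * lattice_weight m) * (ennreal (cmod (f x)) * indicator (dyadic_cube (0, m)) x) \<partial>lebesgue)"
      using h by (intro nn_integral_mono) (auto simp: indicator_def intro!: mult_right_mono ennreal_leI)
    also have "\<dots> = ennreal (2 ^ N * lattice_weight m) * (\<integral>\<^sup>+ x\<in>dyadic_cube (0, m). ennreal (cmod (f x)) \<partial>lebesgue)"
      by (intro nn_integral_cmult) measurable
    also have "\<dots> \<le> ennreal (2 ^ N * lattice_weight m) * ennreal A"
      by (intro mult_left_mono A) auto
    finally show "(\<integral>\<^sup>+ x\<in>dyadic_cube (0, m). ennreal (?h x) * ennreal (cmod (f x)) \<partial>lebesgue) \<le> \<dots>" .
  qed
  also have "\<dots> = (ennreal (2 ^ N) * (\<integral>\<^sup>+ m. ennreal (lattice_weight (m :: int^'n)) \<partial>count_space UNIV)) * ennreal A"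
    by (simp add: ennreal_mult lattice_weight_nonneg nn_integral_cmult nn_integral_multc)
  also have "\<dots> < \<infinity>"
    using lattice_weight_summable[where 'n = 'n] by (simp add: ennreal_mult_less_top)
  finally have W: "W < \<infinity>" .
  have W': "ennreal (enn2real W) = W" using W by simp
  have bnd: "(\<integral>\<^sup>+ x. ennreal (cmod (f x * \<phi> x)) \<partial>lebesgue) \<le> ennreal (schwartz_seminorm N \<phi>) * W" if s: "schwartz \<phi>" for \<phi>
  proof -
    have "cmod (f x * \<phi> x) \<le> schwartz_seminorm N \<phi> * (?h x * cmod (f x))" for x
    proof -
      have "cmod (\<phi> x) \<le> schwartz_seminorm N \<phi> * ?h x"
        using schwartz_seminorm_bound[OF s, of x N] by (simp add: pos_le_divide_eq add_pos_nonneg mult.commute)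
      then have "cmod (\<phi> x) * cmod (f x) \<le> schwartz_seminorm N \<phi> * ?h x * cmod (f x)"
        by (rule mult_right_mono) simp
      then show ?thesis by (simp add: norm_mult mult.commute[of "cmod (f x)"])
    qed
    moreover have "0 \<le> schwartz_seminorm N \<phi>"
      using schwartz_seminorm_bound[OF s, of 0 N] by (rule order_trans[rotated]) simp
    ultimately have "(\<integral>\<^sup>+ x. ennreal (cmod (f x * \<phi> x)) \<partial>lebesgue)
        \<le> (\<integral>\<^sup>+ x. ennreal (schwartz_seminorm N \<phi>) * (ennreal (?h x) * ennreal (cmod (f x))) \<partial>lebesgue)"
      by (intro nn_integral_mono) (simp add: ennreal_leI flip: ennreal_mult)
    also have "\<dots> = ennreal (schwartz_seminorm N \<phi>) * W"
      unfolding W_def by (intro nn_integral_cmult) measurable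
    finally show ?thesis .
  qed
  have meas: "\<phi> \<in> borel_measurable lebesgue" if "schwartz \<phi>" for \<phi> :: "real^'n \<Rightarrow> complex"
    using schwartz_borel_measurable[OF that] by (intro measurable_completion) simp
  show int: "integrable lebesgue (\<lambda>x. f x * \<phi> x)" if s: "schwartz \<phi>" for \<phi>
  proof (rule integrableI_bounded)
    show "(\<lambda>x. f x * \<phi> x) \<in> borel_measurable lebesgue" using meas[OF s] by measurable
    show "(\<integral>\<^sup>+ x. ennreal (cmod (f x * \<phi> x)) \<partial>lebesgue) < \<infinity>"
      by (rule le_less_trans[OF bnd[OF s]]) (use W in \<open>simp add: ennreal_mult_less_top\<close>)
  qed
  show "tempered (dist_of f)"
    unfolding tempered_def
  proof (intro conjI allI impI exI)
    fix \<phi> \<psi> :: "real^'n \<Rightarrow> complex" and a b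
    assume "schwartz \<phi>" "schwartz \<psi>"
    note i = int[OF this(1)] int[OF this(2)]
    have "(\<lambda>x. f x * (a * \<phi> x + b * \<psi> x)) = (\<lambda>x. a * (f x * \<phi> x) + b * (f x * \<psi> x))"
      by (simp add: algebra_simps)
    then show "dist_of f (\<lambda>x. a * \<phi> x + b * \<psi> x) = a * dist_of f \<phi> + b * dist_of f \<psi>"
      unfolding dist_of_def using i by simp
  next
    fix \<phi> :: "real^'n \<Rightarrow> complex"
    assume s: "schwartz \<phi>"
    have nn: "0 \<le> schwartz_seminorm N \<phi>"
      using schwartz_seminorm_bound[OF s, of 0 N] by (rule order_trans[rotated]) simp
    have "ennreal (cmod (dist_of f \<phi>)) \<le> ennreal (schwartz_seminorm N \<phi>) * W"
      unfolding dist_of_def by (rule order_trans[OF norm_integral_le_nn_integral bnd[OF s]])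
    also have "\<dots> = ennreal (enn2real W * schwartz_seminorm N \<phi>)"
      by (subst W'[symmetric]) (simp add: nn mult.commute flip: ennreal_mult)
    finally show "cmod (dist_of f \<phi>) \<le> enn2real W * schwartz_seminorm N \<phi>"
      using nn by (subst (asm) ennreal_le_iff) auto
  qed
qed

section \<open>Tail sums of powers and the T-norm\<close>

lemma powr_telescope_le:
  fixes s x :: real
  assumes "s > 1" "x > 0"
  shows "(s - 1) * (1 + x) powr (- s) \<le> x powr (1 - s) - (1 + x) powr (1 - s)"
proof -
  \<comment> \<open>Mean value theorem for the power \<open>1 - s\<close>; its derivative is
    smallest in modulus at the right end, so the power \<open>- s\<close> is dominated by a
    telescoping difference.\<close>
  have "\<exists>z>x. z < 1 + x \<and> (1 + x) powr (1 - s) - x powr (1 - s) = (1 + x - x) * ((1 - s) * z powr (1 - s - 1))"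
    using assms by (intro MVT2) (auto intro!: derivative_eq_intros)
  then obtain z where z: "z > x" "z < 1 + x" "(1 + x) powr (1 - s) - x powr (1 - s) = (1 - s) * z powr (- s)"
    by auto
  have "(1 + x) powr (- s) \<le> z powr (- s)"
    using z assms by (intro powr_mono2') auto
  then have "(s - 1) * (1 + x) powr (- s) \<le> (s - 1) * z powr (- s)"
    using assms by (intro mult_left_mono) auto
  then show ?thesis using z(3) by (simp add: algebra_simps)
qed

text \<open>For positive \<open>N\<close> the sum telescopes. For \<open>N = 0\<close> the term with
  value 1 is split off first, which explains both \<open>max N 1\<close> and the additional 1 in the
  constant.\<close>

lemma sum_powr_tail_le:
  assumes "s > 1"
  shows "(\<Sum>j<k. (1 + real (j + N)) powr (- s)) \<le> (1 + 1 / (s - 1)) * real (max N 1) powr (1 - s)"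
proof -
  have pos: "(\<Sum>j<k. (1 + real (j + N)) powr (- s)) \<le> 1 / (s - 1) * real N powr (1 - s)" if "N \<ge> 1" for N k
  proof -
    have "(s - 1) * (\<Sum>j<k. (1 + real (j + N)) powr (- s))
        \<le> (\<Sum>j<k. real (j + N) powr (1 - s) - real (Suc j + N) powr (1 - s))"
      unfolding sum_distrib_left
      using powr_telescope_le[OF assms, of "real (_ + N)"] that by (intro sum_mono) (simp add: add.assoc)
    also have "\<dots> = real N powr (1 - s) - real (k + N) powr (1 - s)"
      using sum_lessThan_telescope'[of "\<lambda>j. real (j + N) powr (1 - s)" k] by simp
    also have "\<dots> \<le> real N powr (1 - s)" by simp
    finally show ?thesis using assms by (simp add: field_simps)
  qed
  show ?thesis
  proof (cases "N \<ge> 1")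
    case True
    have "1 / (s - 1) * real N powr (1 - s) \<le> (1 + 1 / (s - 1)) * real N powr (1 - s)"
      by (intro mult_right_mono) auto
    then show ?thesis using pos[OF True, of k] True by (simp add: max_absorb1)
  next
    case False
    have "(\<Sum>j<k. (1 + real j) powr (- s)) \<le> 1 + 1 / (s - 1)"
    proof (cases k)
      case (Suc k')
      show ?thesis
        unfolding Suc sum.lessThan_Suc_shift using pos[of 1 k'] by simp
    qed (use assms in simp)
    moreover have "N = 0" using False by simp
    ultimately show ?thesis by simp
  qed
qed

text \<open>The tail from \<open>N\<close> of the powers with exponent \<open>- 2 * \<alpha>\<close>
  is of size \<open>max N 1\<close> to the power \<open>1 - 2 * \<alpha>\<close>. That is the square
  of \<open>Psi_log \<alpha> N\<close>, so the weight of the T-norm cancels it uniformly in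
  \<open>N\<close>. Both the embedding and the counterexample rest on this criterion.\<close>

lemma T_sq_le:
  assumes "\<alpha> > 1/2"
    and le: "\<And>j. ennreal (2 powr (- 2 * real j)) * L2_sq (LP_op \<phi>0 j u) \<le> B * ennreal ((1 + real j) powr (- 2 * \<alpha>))"
  shows "T_sq \<phi>0 (Psi_log \<alpha>) u \<le> ennreal (1 + 1 / (2 * \<alpha> - 1)) * B"
  unfolding T_sq_def
proof (rule SUP_least)
  fix N
  let ?M = "real (max N 1)"
  define C where "C = 1 + 1 / (2 * \<alpha> - 1)"
  have C: "C \<ge> 0" using assms by (simp add: C_def)
  have "(\<Sum>j. ennreal (2 powr (- 2 * real (j + N))) * L2_sq (LP_op \<phi>0 (j + N) u))
      \<le> (\<Sum>j. B * ennreal ((1 + real (j + N)) powr (- (2 * \<alpha>))))"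
    using le[of "_ + N"] by (intro suminf_le) (simp_all del: of_nat_add)
  also have "\<dots> = B * (\<Sum>j. ennreal ((1 + real (j + N)) powr (- (2 * \<alpha>))))"
    by (rule ennreal_suminf_cmult)
  also have "(\<Sum>j. ennreal ((1 + real (j + N)) powr (- (2 * \<alpha>)))) \<le> ennreal (C * ?M powr (1 - 2 * \<alpha>))"
  proof (intro suminf_le_const summableI)
    fix k
    have "(\<Sum>j<k. (1 + real (j + N)) powr (- (2 * \<alpha>))) \<le> C * ?M powr (1 - 2 * \<alpha>)"
      unfolding C_def using assms(1) by (intro sum_powr_tail_le) simp
    then show "(\<Sum>j<k. ennreal ((1 + real (j + N)) powr (- (2 * \<alpha>)))) \<le> ennreal (C * ?M powr (1 - 2 * \<alpha>))"
      by (subst sum_ennreal) (auto intro: ennreal_leI)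
  qed
  finally have *: "(\<Sum>j. ennreal (2 powr (- 2 * real (j + N))) * L2_sq (LP_op \<phi>0 (j + N) u))
      \<le> B * ennreal (C * ?M powr (1 - 2 * \<alpha>))"
    by (simp add: mult_left_mono)
  have Psi: "Psi_log \<alpha> N powr - 2 = ?M powr (2 * \<alpha> - 1)"
  proof -
    have "(1 / 2 - \<alpha>) * - 2 = 2 * \<alpha> - 1" by simp
    then show ?thesis unfolding Psi_log_def powr_powr by (simp only:)
  qed
  have "?M powr (2 * \<alpha> - 1) * (C * ?M powr (1 - 2 * \<alpha>)) = C"
    by (simp flip: powr_add)
  then have "ennreal (?M powr (2 * \<alpha> - 1)) * (B * ennreal (C * ?M powr (1 - 2 * \<alpha>))) = ennreal C * B"
  proof -
    assume "?M powr (2 * \<alpha> - 1) * (C * ?M powr (1 - 2 * \<alpha>)) = C"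
    then have "ennreal (?M powr (2 * \<alpha> - 1)) * ennreal (C * ?M powr (1 - 2 * \<alpha>)) = ennreal C"
      using C by (subst ennreal_mult[symmetric]) auto
    then show ?thesis by (metis mult.assoc mult.commute)
  qed
  with mult_left_mono[OF *, of "ennreal (?M powr (2 * \<alpha> - 1))"]
  show "ennreal (Psi_log \<alpha> N powr - 2) * (\<Sum>j. ennreal (2 powr (- 2 * real (j + N))) * L2_sq (LP_op \<phi>0 (j + N) u))
    \<le> ennreal (1 + 1 / (2 * \<alpha> - 1)) * B"
    unfolding Psi C_def by simp
qed

text \<open>All cubes of generation \<open>k\<close> together form one disjoint family, hence
  compete in the supremum. They share the coefficient \<open>w\<close>: the volume is
  \<open>2 powr (- k n)\<close> and \<open>1 - 1 / p = 1 / 2 - 1 / n\<close>, which gives the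
  exponent \<open>k (n / 2 - 1)\<close>.\<close>

lemma R_sq_ge_generation:
  fixes f :: "real^'n \<Rightarrow> complex" and k :: int and \<alpha> :: real
  defines "w \<equiv> (1 - min (- (of_int k * real CARD('n) * ln 2)) 0) powr \<alpha> * 2 powr (of_int k * (real CARD('n) / 2 - 1))"
  shows "(\<integral>\<^sup>+ m. (ennreal w * (\<integral>\<^sup>+ x\<in>dyadic_cube (k, m). ennreal (cmod (f x)) \<partial>lebesgue))\<^sup>2 \<partial>count_space UNIV)
    \<le> R_sq (2 * real CARD('n) / (real CARD('n) + 2)) \<alpha> f"
proof -
  define p where "p = 2 * real CARD('n) / (real CARD('n) + 2)"
  let ?g = "\<lambda>Q. (ennreal ((1 - min (ln (dyadic_vol Q)) 0) powr \<alpha> * dyadic_vol Q powr (- (1 - 1 / p)))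
                * (\<integral>\<^sup>+ x\<in>dyadic_cube Q. ennreal (cmod (f x)) \<partial>lebesgue)) ^ 2"
  have n: "real CARD('n) > 0" by simp
  have vol: "dyadic_vol (k, m) = 2 powr (- (of_int k * real CARD('n)))" for m :: "int^'n"
    by (simp add: dyadic_vol_def powr_powr powr_realpow[symmetric])
  have "real CARD('n) * (1 - 1 / p) = real CARD('n) / 2 - 1"
    using n unfolding p_def by (simp add: field_simps)
  then have e: "- (of_int k * real CARD('n)) * - (1 - 1 / p) = of_int k * (real CARD('n) / 2 - 1)"
    by (simp only: minus_mult_minus mult.assoc)
  have w: "w = (1 - min (ln (dyadic_vol (k, m))) 0) powr \<alpha> * dyadic_vol (k, m) powr (- (1 - 1 / p))" for m :: "int^'n"
    unfolding w_def vol powr_powr e by (simp add: ln_powr)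
  have S: "disjoint_dyadic_family (range (Pair k) :: (int \<times> (int^'n)) set)"
    by (auto simp: disjoint_dyadic_family_def dyadic_cube_disjoint)
  have "(\<integral>\<^sup>+ m. (ennreal w * (\<integral>\<^sup>+ x\<in>dyadic_cube (k, m). ennreal (cmod (f x)) \<partial>lebesgue))\<^sup>2 \<partial>count_space UNIV)
      = (\<integral>\<^sup>+ m. ?g (k, m) \<partial>count_space UNIV)"
    by (simp only: w[symmetric])
  also have "\<dots> = (\<integral>\<^sup>+ Q. ?g Q \<partial>count_space (range (Pair k)))"
    by (rule nn_integral_bij_count_space) (auto simp: bij_betw_def inj_on_def)
  also have "\<dots> \<le> R_sq p \<alpha> f"
    unfolding R_sq_def using S by (intro SUP_upper) simp
  finally show ?thesis unfolding p_def .
qed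

lemma ennreal_le_of_power2_le:
  fixes x :: ennreal
  assumes "x\<^sup>2 \<le> ennreal (b\<^sup>2)" "0 \<le> b"
  shows "x \<le> ennreal b"
proof (cases x)
  case (real r)
  then have "r\<^sup>2 \<le> b\<^sup>2" using assms by (simp add: ennreal_power)
  then show ?thesis using real assms(2) by (auto intro: ennreal_leI power2_le_imp_le)
qed (use assms in \<open>simp add: top_unique\<close>)

text \<open>For \<open>k \<le> 0\<close> the side length is at least 1, so the logarithmic factor is
  1. A single term is bounded by the sum over its generation, and taking square roots isolates the
  integral. The case \<open>k = 0\<close> serves temperedness, negative \<open>k\<close> the growth
  at large scales.\<close>

lemma dyadic_average_le_R_sq:
  fixes f :: "real^'n \<Rightarrow> complex"
  assumes "f \<in> R_log (2 * real CARD('n) / (real CARD('n) + 2)) \<alpha>" "k \<le> 0"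
  shows "(\<integral>\<^sup>+ x\<in>dyadic_cube (k, m). ennreal (cmod (f x)) \<partial>lebesgue)
    \<le> ennreal (sqrt (enn2real (R_sq (2 * real CARD('n) / (real CARD('n) + 2)) \<alpha> f)) * 2 powr (- of_int k * (real CARD('n) / 2 - 1)))"
proof -
  define p where "p = 2 * real CARD('n) / (real CARD('n) + 2)"
  define c where "c = (\<lambda>m. \<integral>\<^sup>+ x\<in>dyadic_cube (k, m). ennreal (cmod (f x)) \<partial>lebesgue)"
  define v where "v = 2 powr (of_int k * (real CARD('n) / 2 - 1))"
  have v: "v > 0" by (simp add: v_def)
  have fin: "R_sq p \<alpha> f < \<infinity>" using assms by (simp add: R_log_def p_def)
  have "(1 - min (- (real_of_int k * real CARD('n) * ln 2)) 0) = 1"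
  proof -
    have "real_of_int k * real CARD('n) * ln 2 \<le> 0"
      using assms(2) by (intro mult_nonpos_nonneg) auto
    then show ?thesis by (simp add: min_absorb2)
  qed
  then have "(\<integral>\<^sup>+ m. (ennreal v * c m)\<^sup>2 \<partial>count_space UNIV) \<le> R_sq p \<alpha> f"
    using R_sq_ge_generation[of k \<alpha> f] by (simp add: c_def v_def p_def)
  moreover have "(ennreal v * c m)\<^sup>2 \<le> (\<integral>\<^sup>+ m. (ennreal v * c m)\<^sup>2 \<partial>count_space UNIV)"
    by (rule nn_integral_ge_point) simp
  ultimately have "(ennreal v * c m)\<^sup>2 \<le> R_sq p \<alpha> f" by (rule order_trans[rotated])
  also have "\<dots> = ennreal ((sqrt (enn2real (R_sq p \<alpha> f)))\<^sup>2)"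
    using fin by simp
  finally have "ennreal v * c m \<le> ennreal (sqrt (enn2real (R_sq p \<alpha> f)))"
    by (rule ennreal_le_of_power2_le) simp
  then have "ennreal (1 / v) * (ennreal v * c m) \<le> ennreal (1 / v) * ennreal (sqrt (enn2real (R_sq p \<alpha> f)))"
    by (rule mult_left_mono) simp
  then have "c m \<le> ennreal (sqrt (enn2real (R_sq p \<alpha> f)) * (1 / v))"
  proof -
    have "ennreal (1 / v) * ennreal v = 1" using v by (simp flip: ennreal_mult)
    moreover have "ennreal (1 / v) * ennreal (sqrt (enn2real (R_sq p \<alpha> f))) = ennreal (sqrt (enn2real (R_sq p \<alpha> f)) * (1 / v))"
      using v by (subst ennreal_mult[symmetric]) (simp_all add: mult.commute)
    ultimately show ?thesis
      using \<open>ennreal (1 / v) * (ennreal v * c m) \<le> _\<close> by (simp only: mult.assoc[symmetric] mult_1)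
  qed
  then show ?thesis unfolding c_def p_def v_def by (simp add: powr_minus_divide)
qed

text \<open>With this \<open>p\<close> the squared coefficient of a cube of generation
  \<open>j\<close> contains precisely \<open>2 powr (- 2 j)\<close> from the T-norm and
  \<open>2 ^ (j n)\<close> from the Schur estimate. Only the logarithmic factor remains, and it
  supplies the decay needed in \<open>T_sq_le\<close>.\<close>

lemma R_log_embedding:
  fixes \<phi>0 :: "real^'n \<Rightarrow> real"
  assumes n2: "CARD('n) \<ge> 2" and "\<alpha> > 1/2" and "LP_generator \<phi>0"
  shows "\<exists>C::real. \<forall>f\<in>R_log (2 * real CARD('n) / (real CARD('n) + 2)) \<alpha>.
            dist_of f \<in> T_space \<phi>0 (Psi_log \<alpha>) \<and>
            T_sq \<phi>0 (Psi_log \<alpha>) (dist_of f)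
              \<le> ennreal C * R_sq (2 * real CARD('n) / (real CARD('n) + 2)) \<alpha> f"
proof -
  define p where "p = 2 * real CARD('n) / (real CARD('n) + 2)"
  obtain C where C: "C \<ge> 0" "\<And>j f. f \<in> borel_measurable lebesgue \<Longrightarrow>
    L2_sq (LP_op \<phi>0 j (dist_of f)) \<le> ennreal (C * (2 ^ j) ^ CARD('n)) *
      (\<integral>\<^sup>+ m. (\<integral>\<^sup>+ x\<in>dyadic_cube (int j, m). ennreal (cmod (f x)) \<partial>lebesgue)\<^sup>2 \<partial>count_space UNIV)"
    using LP_op_L2_bound[OF assms(3)] by blast
  define C' where "C' = 1 + 1 / (2 * \<alpha> - 1)"
  have C': "C' \<ge> 0" using assms by (simp add: C'_def)
  have "dist_of f \<in> T_space \<phi>0 (Psi_log \<alpha>) \<and> T_sq \<phi>0 (Psi_log \<alpha>) (dist_of f) \<le> ennreal (C' * C) * R_sq p \<alpha> f"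
    if f: "f \<in> R_log p \<alpha>" for f :: "real^'n \<Rightarrow> complex"
  proof -
    have meas: "f \<in> borel_measurable lebesgue" and fin: "R_sq p \<alpha> f < \<infinity>"
      using f by (auto simp: R_log_def locally_integrable_def)
    \<comment> \<open>Generation 0 bounds the integrals over unit cubes.\<close>
    have "tempered (dist_of f)"
      using dyadic_average_le_R_sq[OF f[unfolded p_def], of 0] by (intro tempered_dist_of[OF meas]) simp
    moreover have "T_sq \<phi>0 (Psi_log \<alpha>) (dist_of f) \<le> ennreal C' * (ennreal C * R_sq p \<alpha> f)"
      unfolding C'_def
    proof (rule T_sq_le[OF assms(2)])
      fix j
      define S where "S = (\<integral>\<^sup>+ m. (\<integral>\<^sup>+ x\<in>dyadic_cube (int j, m). ennreal (cmod (f x)) \<partial>lebesgue)\<^sup>2 \<partial>count_space UNIV)"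
      define l where "l = 1 + real j * real CARD('n) * ln 2"
      define w where "w = l powr \<alpha> * 2 powr (real j * (real CARD('n) / 2 - 1))"
      \<comment> \<open>Here the dimension enters: \<open>n \<ge> 2\<close> gives
        \<open>n * ln 2 \<ge> 1\<close>, so the logarithmic factor grows at least like
        \<open>1 + j\<close>.\<close>
      have l: "1 + real j \<le> l"
      proof -
        have "1 \<le> 2 * ln (2::real)" using ln2_ge_two_thirds by simp
        also have "\<dots> \<le> real CARD('n) * ln 2" using n2 by (intro mult_right_mono) auto
        finally show ?thesis using mult_left_mono[of 1 "real CARD('n) * ln 2" "real j"]
          by (simp add: l_def mult.assoc)
      qed
      have w2: "w\<^sup>2 = l powr (2 * \<alpha>) * (2 powr (- 2 * real j) * (2 ^ j) ^ CARD('n))"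
      proof -
        have "(2 powr (real j * (real CARD('n) / 2 - 1)))\<^sup>2 = 2 powr (real j * real CARD('n) - 2 * real j)"
          by (simp add: powr_power algebra_simps)
        also have "\<dots> = 2 powr (- 2 * real j) * (2 ^ j) ^ CARD('n)"
          by (simp add: powr_diff powr_minus_divide powr_realpow[symmetric] powr_powr power_mult[symmetric])
        moreover have "(l powr \<alpha>)\<^sup>2 = l powr (2 * \<alpha>)"
          by (simp add: power2_eq_square flip: powr_add)
        ultimately show ?thesis
          by (simp only: w_def power_mult_distrib)
      qed
      have "1 - min (- (real_of_int (int j) * real CARD('n) * ln 2)) 0 = l"
        by (simp add: l_def min_def)
      then have "(\<integral>\<^sup>+ m. (ennreal w * (\<integral>\<^sup>+ x\<in>dyadic_cube (int j, m). ennreal (cmod (f x)) \<partial>lebesgue))\<^sup>2 \<partial>count_space UNIV) \<le> R_sq p \<alpha> f"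
        using R_sq_ge_generation[of "int j" \<alpha> f] by (simp add: w_def p_def)
      then have R: "ennreal (w\<^sup>2) * S \<le> R_sq p \<alpha> f"
        by (simp add: S_def power_mult_distrib nn_integral_cmult ennreal_power w_def)
      have "ennreal (2 powr (- 2 * real j)) * L2_sq (LP_op \<phi>0 j (dist_of f))
          \<le> ennreal (2 powr (- 2 * real j)) * (ennreal (C * (2 ^ j) ^ CARD('n)) * S)"
        unfolding S_def by (intro mult_left_mono C(2) meas) auto
      also have "\<dots> = ennreal (C * l powr (- 2 * \<alpha>)) * (ennreal (w\<^sup>2) * S)"
      proof -
        have "l > 0" using l by simp
        then have "2 powr (- 2 * real j) * (C * (2 ^ j) ^ CARD('n)) = C * l powr (- 2 * \<alpha>) * w\<^sup>2"
          unfolding w2 by (simp add: powr_minus field_simps)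
        then have "ennreal (2 powr (- 2 * real j)) * ennreal (C * (2 ^ j) ^ CARD('n)) = ennreal (C * l powr (- 2 * \<alpha>)) * ennreal (w\<^sup>2)"
          using C(1) by (subst (1 2) ennreal_mult[symmetric]) auto
        then show ?thesis by (metis mult.assoc)
      qed
      also have "\<dots> \<le> ennreal (C * (1 + real j) powr (- 2 * \<alpha>)) * R_sq p \<alpha> f"
        using l C(1) assms(2) by (intro mult_mono R ennreal_leI mult_left_mono powr_mono2') auto
      finally show "ennreal (2 powr (- 2 * real j)) * L2_sq (LP_op \<phi>0 j (dist_of f))
          \<le> ennreal C * R_sq p \<alpha> f * ennreal ((1 + real j) powr (- 2 * \<alpha>))"
        using C(1) by (simp add: ennreal_mult ac_simps)
    qed
    then have T: "T_sq \<phi>0 (Psi_log \<alpha>) (dist_of f) \<le> ennreal (C' * C) * R_sq p \<alpha> f"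
      using C C' by (simp add: ennreal_mult mult.assoc)
    moreover have "ennreal (C' * C) * R_sq p \<alpha> f < \<infinity>"
      using fin by (simp add: ennreal_mult_less_top)
    ultimately show ?thesis by (auto simp: T_space_def intro: le_less_trans)
  qed
  then show ?thesis unfolding p_def by blast
qed

section \<open>Strictness\<close>

text \<open>For L2 functions the factor \<open>2 powr (- 2 j)\<close> is the only source of decay in
  \<open>j\<close>; it beats every negative power of \<open>1 + j\<close>.\<close>

lemma powr_le_exponential:
  fixes a :: real
  assumes "a > 0"
  obtains K where "K \<ge> 0" "\<And>j. 2 powr (- 2 * real j) \<le> K * (1 + real j) powr (- a)"
proof -
  \<comment> \<open>Chosen so that the \<open>a\<close>-th power of \<open>exp (e * (1 + j))\<close>
    is \<open>2 powr (2 + 2 * j)\<close>; raising the inequality \<open>x \<le> exp x\<close> at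
    \<open>x = e * (1 + j)\<close> to that power gives the claim.\<close>
  define e where "e = 2 * ln 2 / a"
  have e: "e > 0" using assms by (simp add: e_def)
  have "2 powr (- 2 * real j) \<le> 4 / e powr a * (1 + real j) powr (- a)" for j
  proof -
    have "e * (1 + real j) \<le> exp (e * (1 + real j))"
      using exp_ge_add_one_self[of "e * (1 + real j)"] by linarith
    then have "(e * (1 + real j)) powr a \<le> exp (e * (1 + real j)) powr a"
      using e assms by (intro powr_mono2) auto
    also have "\<dots> = 4 * 2 powr (2 * real j)"
    proof -
      have "exp (e * (1 + real j)) powr a = exp (2 * ln 2 * (1 + real j))"
        using assms by (simp add: powr_def e_def)
      also have "\<dots> = 2 powr (2 + 2 * real j)" by (simp add: powr_def algebra_simps)
      finally show ?thesis by (simp add: powr_add)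
    qed
    finally have "e powr a * (1 + real j) powr a \<le> 4 * 2 powr (2 * real j)"
      using e by (simp add: powr_mult)
    then show ?thesis
      using e by (simp add: powr_minus field_simps)
  qed
  moreover have "0 \<le> 4 / e powr a" by simp
  ultimately show ?thesis using that by blast
qed

text \<open>The exponent exceeds \<open>n / 2\<close>, so the function lies in L2, but only by
  \<open>1 / 2\<close>, so its integral over a ball of large radius \<open>r\<close> still grows at
  least like the power \<open>(n - 1) / 2\<close> of \<open>r\<close>.\<close>

definition slow_decay :: "real^'n \<Rightarrow> complex" where
  "slow_decay x = complex_of_real ((1 + norm x) powr (- ((real CARD('n) + 1) / 2)))"

lemma slow_decay_measurable: "slow_decay \<in> borel_measurable borel"
  unfolding slow_decay_def by measurable

lemma slow_decay_le_1: "cmod (slow_decay x) \<le> 1"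
proof -
  have "(1 + norm x) powr (- ((real CARD('a) + 1) / 2)) \<le> (1 + norm x) powr 0"
    by (intro powr_mono) auto
  moreover have "1 + norm x > 0" by (simp add: add_pos_nonneg)
  ultimately show ?thesis by (simp add: slow_decay_def)
qed

lemma slow_decay_square: "(cmod (slow_decay (x :: real^'n)))\<^sup>2 = 1 / (1 + norm x) ^ (CARD('n) + 1)"
proof -
  have "(cmod (slow_decay x))\<^sup>2 = (1 + norm x) powr (- ((real CARD('n) + 1) / 2) + - ((real CARD('n) + 1) / 2))"
  proof -
    have "cmod (slow_decay x) = (1 + norm x) powr (- ((real CARD('n) + 1) / 2))"
      by (simp add: slow_decay_def)
    then show ?thesis by (simp only: powr_add power2_eq_square)
  qed
  also have "- ((real CARD('n) + 1) / 2) + - ((real CARD('n) + 1) / 2) = - real (CARD('n) + 1)"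
    by simp
  also have "(1 + norm x) powr (- real (CARD('n) + 1)) = 1 / (1 + norm x) ^ (CARD('n) + 1)"
    unfolding powr_minus_divide by (subst powr_realpow) (auto simp: add_pos_nonneg)
  finally show ?thesis .
qed

lemma slow_decay_unit_cube_average:
  "(\<integral>\<^sup>+ x\<in>dyadic_cube (0, m). ennreal (cmod (slow_decay x)) \<partial>lebesgue) \<le> ennreal 1"
proof -
  have "(\<integral>\<^sup>+ x\<in>dyadic_cube (0, m). ennreal (cmod (slow_decay x)) \<partial>lebesgue)
      \<le> (\<integral>\<^sup>+ x. indicator (dyadic_cube (0, m)) x \<partial>lebesgue)"
    using slow_decay_le_1 by (intro nn_integral_mono) (auto simp: indicator_def)
  also have "\<dots> \<le> ennreal 1"
    using emeasure_dyadic_cube_le[of "(0, m)"] by (simp add: dyadic_vol_def)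
  finally show ?thesis .
qed

text \<open>Cauchy-Schwarz against the indicator of the cube, using that indicators are
  idempotent.\<close>

lemma dyadic_average_square_le:
  assumes [measurable]: "f \<in> borel_measurable lebesgue"
  shows "(\<integral>\<^sup>+ x\<in>dyadic_cube Q. ennreal (cmod (f x)) \<partial>lebesgue)\<^sup>2
    \<le> ennreal (dyadic_vol Q) * (\<integral>\<^sup>+ x\<in>dyadic_cube Q. ennreal ((cmod (f x))\<^sup>2) \<partial>lebesgue)"
proof -
  let ?i = "indicator (dyadic_cube Q) :: _ \<Rightarrow> ennreal"
  have "(\<integral>\<^sup>+ x. ?i x * (ennreal (cmod (f x)) * ?i x) \<partial>lebesgue)\<^sup>2
      \<le> (\<integral>\<^sup>+ x. (?i x)\<^sup>2 \<partial>lebesgue) * (\<integral>\<^sup>+ x. (ennreal (cmod (f x)) * ?i x)\<^sup>2 \<partial>lebesgue)"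
    by (rule Cauchy_Schwarz_nn_integral) measurable
  moreover have "?i x * (ennreal (cmod (f x)) * ?i x) = ennreal (cmod (f x)) * ?i x" for x
    by (simp add: indicator_def)
  moreover have "(?i x)\<^sup>2 = ?i x" for x by (simp add: indicator_def)
  moreover have "(ennreal (cmod (f x)) * ?i x)\<^sup>2 = ennreal ((cmod (f x))\<^sup>2) * ?i x" for x
    by (simp add: indicator_def ennreal_power)
  ultimately have "(\<integral>\<^sup>+ x. ennreal (cmod (f x)) * ?i x \<partial>lebesgue)\<^sup>2
      \<le> (\<integral>\<^sup>+ x. ?i x \<partial>lebesgue) * (\<integral>\<^sup>+ x. ennreal ((cmod (f x))\<^sup>2) * ?i x \<partial>lebesgue)"
    by (simp only:)
  also have "\<dots> \<le> ennreal (dyadic_vol Q) * (\<integral>\<^sup>+ x. ennreal ((cmod (f x))\<^sup>2) * ?i x \<partial>lebesgue)"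
    using emeasure_dyadic_cube_le[of Q] by (intro mult_right_mono) auto
  finally show ?thesis .
qed

text \<open>Cauchy-Schwarz on each cube produces its volume, which cancels the factor
  \<open>2 ^ (j n)\<close> of the Schur estimate. The operators are thus bounded on L2 uniformly in
  \<open>j\<close>, and \<open>2 powr (- 2 j)\<close> decays faster than required.\<close>

lemma dist_of_L2_in_T_space:
  fixes \<phi>0 :: "real^'n \<Rightarrow> real" and f :: "real^'n \<Rightarrow> complex"
  assumes "LP_generator \<phi>0" and \<alpha>: "\<alpha> > 1/2" and [measurable]: "f \<in> borel_measurable lebesgue"
    and fin: "L2_sq f < \<infinity>" and temp: "tempered (dist_of f)"
  shows "dist_of f \<in> T_space \<phi>0 (Psi_log \<alpha>)"
proof -
  obtain C where C: "C \<ge> 0" "\<And>j f. f \<in> borel_measurable lebesgue \<Longrightarrow>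
    L2_sq (LP_op \<phi>0 j (dist_of f)) \<le> ennreal (C * (2 ^ j) ^ CARD('n)) *
      (\<integral>\<^sup>+ m. (\<integral>\<^sup>+ x\<in>dyadic_cube (int j, m). ennreal (cmod (f x)) \<partial>lebesgue)\<^sup>2 \<partial>count_space UNIV)"
    using LP_op_L2_bound[OF assms(1)] by blast
  obtain K where K: "K \<ge> 0" "\<And>j. 2 powr (- 2 * real j) \<le> K * (1 + real j) powr (- (2 * \<alpha>))"
    using powr_le_exponential[of "2 * \<alpha>"] \<alpha> by auto
  have L2: "L2_sq (LP_op \<phi>0 j (dist_of f)) \<le> ennreal C * L2_sq f" for j
  proof -
    define V where "V = ((2::real) ^ j) ^ CARD('n)"
    have V: "V > 0" by (simp add: V_def)
    have vol: "dyadic_vol (int j, m) = 1 / V" for m :: "int^'n"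
      by (simp add: dyadic_vol_def V_def powr_minus_divide powr_realpow power_one_over)
    have "(\<integral>\<^sup>+ m. (\<integral>\<^sup>+ x\<in>dyadic_cube (int j, m). ennreal (cmod (f x)) \<partial>lebesgue)\<^sup>2 \<partial>count_space UNIV)
        \<le> (\<integral>\<^sup>+ m. ennreal (1 / V) * (\<integral>\<^sup>+ x\<in>dyadic_cube (int j, m). ennreal ((cmod (f x))\<^sup>2) \<partial>lebesgue) \<partial>count_space UNIV)"
      using dyadic_average_square_le[OF assms(3), of "(int j, _)"] by (intro nn_integral_mono) (simp only: vol)
    also have "\<dots> = ennreal (1 / V) * L2_sq f"
      unfolding L2_sq_def
      by (subst nn_integral_cmult, simp, subst nn_integral_dyadic_partition[of _ "int j"], measurable)
    finally have "(\<integral>\<^sup>+ m. (\<integral>\<^sup>+ x\<in>dyadic_cube (int j, m). ennreal (cmod (f x)) \<partial>lebesgue)\<^sup>2 \<partial>count_space UNIV)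
      \<le> ennreal (1 / V) * L2_sq f" .
    then have "ennreal (C * V) * (\<integral>\<^sup>+ m. (\<integral>\<^sup>+ x\<in>dyadic_cube (int j, m). ennreal (cmod (f x)) \<partial>lebesgue)\<^sup>2 \<partial>count_space UNIV)
      \<le> ennreal (C * V) * (ennreal (1 / V) * L2_sq f)"
      by (rule mult_left_mono) simp
    also have "\<dots> = ennreal C * L2_sq f"
    proof -
      have "ennreal (C * V) * ennreal (1 / V) = ennreal C"
        using V C(1) by (subst ennreal_mult[symmetric]) auto
      then show ?thesis by (metis mult.assoc)
    qed
    finally show ?thesis
      using order_trans[OF C(2)[OF assms(3), of j]] unfolding V_def by blast
  qed
  have "T_sq \<phi>0 (Psi_log \<alpha>) (dist_of f) \<le> ennreal (1 + 1 / (2 * \<alpha> - 1)) * (ennreal (K * C) * L2_sq f)"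
  proof (rule T_sq_le[OF \<alpha>])
    fix j
    have "ennreal (2 powr (- 2 * real j)) * L2_sq (LP_op \<phi>0 j (dist_of f))
        \<le> ennreal (K * (1 + real j) powr (- (2 * \<alpha>))) * (ennreal C * L2_sq f)"
      by (intro mult_mono ennreal_leI K L2) auto
    also have "\<dots> = ennreal (K * C) * L2_sq f * ennreal ((1 + real j) powr (- 2 * \<alpha>))"
      using K(1) C(1) by (simp add: ennreal_mult ac_simps)
    finally show "ennreal (2 powr (- 2 * real j)) * L2_sq (LP_op \<phi>0 j (dist_of f)) \<le> \<dots>" .
  qed
  also have "\<dots> < \<infinity>" using fin by (simp add: ennreal_mult_less_top)
  finally show ?thesis using temp by (simp add: T_space_def)
qed

text \<open>The dilate of \<open>\<phi>0\<close> is nonnegative and equals 1 on the ball of radius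
  \<open>r = 2 ^ k\<close>, where \<open>slow_decay\<close> is at least
  \<open>(2 * r) powr (- b)\<close>. Multiplying by the volume of the ball gives the growth exponent
  \<open>n - b = (n - 1) / 2\<close>.\<close>

lemma slow_decay_pairing_lower_bound:
  fixes \<phi>0 :: "real^'n \<Rightarrow> real"
  assumes "LP_generator \<phi>0"
  obtains c where "c > 0"
    "\<And>k. c * 2 powr (real k * (real CARD('n) - 1) / 2) \<le> cmod (dist_of slow_decay (\<lambda>x. complex_of_real (\<phi>0 ((1 / 2 ^ k) *\<^sub>R x))))"
proof -
  have sch: "schwartz (\<lambda>\<xi>. complex_of_real (\<phi>0 \<xi>))" and nn: "\<And>\<xi>. 0 \<le> \<phi>0 \<xi>"
    and one: "\<And>\<xi>. norm \<xi> \<le> 1 \<Longrightarrow> \<phi>0 \<xi> = 1"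
    using assms by (auto simp: LP_generator_def)
  define b where "b = (real CARD('n) + 1) / 2"
  have b: "b > 0" by (simp add: b_def)
  define v where "v = unit_ball_vol (real CARD('n))"
  define c where "c = v * 2 powr (- b)"
  have "c > 0" unfolding c_def v_def by simp
  moreover have "c * 2 powr (real k * (real CARD('n) - 1) / 2)
      \<le> cmod (dist_of slow_decay (\<lambda>x. complex_of_real (\<phi>0 ((1 / 2 ^ k) *\<^sub>R x))))" for k
  proof -
    define r where "r = (2::real) ^ k"
    have r: "r \<ge> 1" by (simp add: r_def)
    let ?\<phi> = "\<lambda>x. \<phi>0 ((1 / r) *\<^sub>R x)"
    let ?g = "\<lambda>x::real^'n. (1 + norm x) powr (- b)"
    have "schwartz (\<lambda>x. complex_of_real (?\<phi> x))"
      using schwartz_scaleR[OF sch, of "1 / r"] r by simp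
    then have "integrable lebesgue (\<lambda>x. slow_decay x * complex_of_real (?\<phi> x))"
      by (intro schwartz_product_integrable[OF _ slow_decay_unit_cube_average] measurable_completion)
        (auto simp: slow_decay_measurable)
    then have "integrable lebesgue (\<lambda>x. complex_of_real (?g x * ?\<phi> x))"
      by (simp add: slow_decay_def b_def)
    then have int: "integrable lebesgue (\<lambda>x. ?g x * ?\<phi> x)"
      using integrable_Re by fastforce
    have "dist_of slow_decay (\<lambda>x. complex_of_real (?\<phi> x)) = complex_of_real (LINT x|lebesgue. ?g x * ?\<phi> x)"
      unfolding dist_of_def slow_decay_def b_def[symmetric] of_real_mult[symmetric]
      by (rule integral_complex_of_real)
    moreover have "c * 2 powr (real k * (real CARD('n) - 1) / 2) \<le> (LINT x|lebesgue. ?g x * ?\<phi> x)"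
    proof -
      have "c * 2 powr (real k * (real CARD('n) - 1) / 2) = (2 * r) powr (- b) * (v * r ^ CARD('n))"
      proof -
        have "r powr (- b) * r ^ CARD('n) = 2 powr (real k * (real CARD('n) - 1) / 2)"
        proof -
          have "r = 2 powr real k" by (simp add: r_def powr_realpow)
          moreover have "r ^ CARD('n) = r powr real CARD('n)" using r by (simp add: powr_realpow)
          moreover have "real k * - b + real k * real CARD('n) = real k * (real CARD('n) - 1) / 2"
            by (simp add: b_def field_simps)
          ultimately show ?thesis by (simp only: powr_powr powr_add[symmetric])
        qed
        then show ?thesis using r by (simp add: c_def powr_mult)
      qed
      also have "\<dots> = (LINT x|lebesgue. (2 * r) powr (- b) * indicator (cball (0::real^'n) r) x)"
        using r content_cball[of r "0 :: real^'n"] by (simp add: v_def)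
      also have "\<dots> \<le> (LINT x|lebesgue. ?g x * ?\<phi> x)"
      proof (rule integral_mono[OF _ int])
        show "integrable lebesgue (\<lambda>x. (2 * r) powr (- b) * indicator (cball (0::real^'n) r) x)"
          by (intro integrable_mult_right integrable_real_indicator) (use emeasure_bounded_finite[OF bounded_cball, of "0 :: real^'n" r] in \<open>auto simp: top.not_eq_extremum\<close>)
        fix x :: "real^'n"
        show "(2 * r) powr (- b) * indicator (cball 0 r) x \<le> ?g x * ?\<phi> x"
        proof (cases "norm x \<le> r")
          case True
          then have "?\<phi> x = 1" using r by (intro one) (simp add: divide_simps)
          moreover have "(2 * r) powr (- b) \<le> ?g x"
            using True r b by (intro powr_mono2') (auto simp: add_pos_nonneg)
          ultimately show ?thesis using True by simp
        next
          case False
          then show ?thesis using nn by (simp add: indicator_def)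
        qed
      qed
      finally show ?thesis .
    qed
    ultimately show ?thesis unfolding r_def by (simp add: order_trans[OF _ abs_ge_self])
  qed
  ultimately show ?thesis using that by blast
qed

text \<open>The dilate of \<open>\<phi>0\<close> is at most 1 and vanishes outside the ball of
  radius \<open>2 * 2 ^ k\<close>. That ball meets a number of cubes of side \<open>2 ^ k\<close>
  bounded independently of \<open>k\<close>, and the R-norm controls the integral over each of
  them.\<close>

lemma R_log_pairing_upper_bound:
  fixes \<phi>0 :: "real^'n \<Rightarrow> real" and f :: "real^'n \<Rightarrow> complex"
  assumes "LP_generator \<phi>0" and f: "f \<in> R_log (2 * real CARD('n) / (real CARD('n) + 2)) \<alpha>"
  obtains B where "\<And>k. cmod (dist_of f (\<lambda>x. complex_of_real (\<phi>0 ((1 / 2 ^ k) *\<^sub>R x)))) \<le> B * 2 powr (real k * (real CARD('n) / 2 - 1))"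
proof -
  have \<phi>0: "\<And>\<xi>. 0 \<le> \<phi>0 \<xi>" "\<And>\<xi>. \<phi>0 \<xi> \<le> 1" "\<And>\<xi>. 2 \<le> norm \<xi> \<Longrightarrow> \<phi>0 \<xi> = 0"
    using assms by (auto simp: LP_generator_def)
  have [measurable]: "f \<in> borel_measurable lebesgue"
    using f by (auto simp: R_log_def locally_integrable_def)
  define A where "A = sqrt (enn2real (R_sq (2 * real CARD('n) / (real CARD('n) + 2)) \<alpha> f))"
  \<comment> \<open>Points of the ball have coordinates strictly between \<open>- 2 * r\<close> and
    \<open>2 * r\<close>, so the floors of their quotients by \<open>r\<close> range over -2, -1, 0,
    1.\<close>
  define F where "F = {m :: int^'n. \<forall>i. m $ i \<in> {-2..1}}"
  have F: "finite F" unfolding F_def by (rule finite_vec_box) simp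
  have "cmod (dist_of f (\<lambda>x. complex_of_real (\<phi>0 ((1 / 2 ^ k) *\<^sub>R x)))) \<le> (real (card F) * A) * 2 powr (real k * (real CARD('n) / 2 - 1))" for k
  proof -
    define r where "r = (2::real) ^ k"
    have r: "r > 0" "2 powr of_int (- int k) = 1 / r" by (simp_all add: r_def powr_minus_divide powr_realpow)
    define h where "h = (\<lambda>x. ennreal (cmod (f x)) * indicator (ball 0 (2 * r)) x)"
    have [measurable]: "ball (0::real^'n) (2 * r) \<in> sets lebesgue"
      by (intro sets_completionI_sets) simp
    have [measurable]: "h \<in> borel_measurable lebesgue" unfolding h_def by measurable
    define P where "P = 2 powr (real k * (real CARD('n) / 2 - 1))"
    have "ennreal (cmod (dist_of f (\<lambda>x. complex_of_real (\<phi>0 ((1 / r) *\<^sub>R x)))))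
        \<le> (\<integral>\<^sup>+ x. ennreal (cmod (f x * complex_of_real (\<phi>0 ((1 / r) *\<^sub>R x)))) \<partial>lebesgue)"
      unfolding dist_of_def by (rule norm_integral_le_nn_integral)
    also have "\<dots> \<le> (\<integral>\<^sup>+ x. h x \<partial>lebesgue)"
    proof (intro nn_integral_mono)
      fix x :: "real^'n"
      show "ennreal (cmod (f x * complex_of_real (\<phi>0 ((1 / r) *\<^sub>R x)))) \<le> h x"
      proof (cases "norm x < 2 * r")
        case True
        then show ?thesis
          using \<phi>0(1,2)[of "(1 / r) *\<^sub>R x"] by (simp add: h_def norm_mult mult_left_le ennreal_leI)
      next
        case False
        then have "\<phi>0 ((1 / r) *\<^sub>R x) = 0" using r by (intro \<phi>0(3)) (simp add: divide_simps)
        then show ?thesis by simp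
      qed
    qed
    also have "\<dots> = (\<integral>\<^sup>+ m. (\<integral>\<^sup>+ x\<in>dyadic_cube (- int k, m). h x \<partial>lebesgue) \<partial>count_space UNIV)"
      by (rule nn_integral_dyadic_partition) measurable
    also have "\<dots> = (\<Sum>m\<in>F. (\<integral>\<^sup>+ x\<in>dyadic_cube (- int k, m). h x \<partial>lebesgue))"
    proof (rule nn_integral_count_space'[OF F])
      fix m assume "m \<notin> F"
      have "h x * indicator (dyadic_cube (- int k, m)) x = 0" for x
      proof (rule ccontr)
        assume "h x * indicator (dyadic_cube (- int k, m)) x \<noteq> 0"
        then have x: "norm x < 2 * r" "x \<in> dyadic_cube (- int k, m)"
          by (auto simp: h_def indicator_def split: if_splits)
        have "m $ i \<in> {-2..1}" for i
        proof -
          have "\<bar>x $ i\<bar> < 2 * r" using component_le_norm_cart[of x i] x(1) by linarith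
          then have "- 2 < x $ i / r" "x $ i / r < 2" using r by (auto simp: abs_less_iff field_simps)
          moreover have "m $ i = \<lfloor>x $ i / r\<rfloor>" using x(2) r by (simp add: mem_dyadic_cube_iff)
          ultimately show ?thesis by (auto simp: le_floor_iff floor_le_iff)
        qed
        then show False using \<open>m \<notin> F\<close> by (simp add: F_def)
      qed
      then show "(\<integral>\<^sup>+ x\<in>dyadic_cube (- int k, m). h x \<partial>lebesgue) = 0"
        by (simp only: nn_integral_const mult_zero_left)
    qed auto
    also have "\<dots> \<le> (\<Sum>m\<in>F. ennreal (A * P))"
    proof (intro sum_mono)
      fix m
      have "(\<integral>\<^sup>+ x\<in>dyadic_cube (- int k, m). h x \<partial>lebesgue)
          \<le> (\<integral>\<^sup>+ x\<in>dyadic_cube (- int k, m). ennreal (cmod (f x)) \<partial>lebesgue)"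
        by (intro nn_integral_mono) (auto simp: h_def indicator_def)
      also have "\<dots> \<le> ennreal (A * P)"
        using dyadic_average_le_R_sq[OF f, of "- int k" m] by (simp add: A_def P_def)
      finally show "(\<integral>\<^sup>+ x\<in>dyadic_cube (- int k, m). h x \<partial>lebesgue) \<le> ennreal (A * P)" .
    qed
    also have "\<dots> = ennreal (real (card F) * (A * P))"
      by (simp add: ennreal_mult' ennreal_of_nat_eq_real_of_nat)
    finally have "cmod (dist_of f (\<lambda>x. complex_of_real (\<phi>0 ((1 / r) *\<^sub>R x)))) \<le> real (card F) * (A * P)"
      by (subst (asm) ennreal_le_iff) (auto simp: A_def P_def)
    then show ?thesis by (simp add: r_def P_def mult.assoc)
  qed
  then show ?thesis using that by blast
qed

text \<open>If \<open>f\<close> represented the same distribution, the lower and upper bounds for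
  the pairings with the dilates would both apply. Their growth exponents \<open>(n - 1) / 2\<close>
  and \<open>n / 2 - 1\<close> differ by \<open>1 / 2\<close>, so powers of \<open>sqrt 2\<close>
  would stay bounded.\<close>

lemma slow_decay_not_represented_in_R_log:
  fixes \<phi>0 :: "real^'n \<Rightarrow> real" and f :: "real^'n \<Rightarrow> complex"
  assumes "LP_generator \<phi>0" and f: "f \<in> R_log (2 * real CARD('n) / (real CARD('n) + 2)) \<alpha>"
  shows "\<exists>\<phi>. schwartz \<phi> \<and> dist_of slow_decay \<phi> \<noteq> dist_of f \<phi>"
proof (rule ccontr)
  assume *: "\<not> ?thesis"
  obtain c where c: "c > 0"
    "\<And>k. c * 2 powr (real k * (real CARD('n) - 1) / 2) \<le> cmod (dist_of slow_decay (\<lambda>x. complex_of_real (\<phi>0 ((1 / 2 ^ k) *\<^sub>R x))))"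
    using slow_decay_pairing_lower_bound[OF assms(1)] by blast
  obtain B where B:
    "\<And>k. cmod (dist_of f (\<lambda>x. complex_of_real (\<phi>0 ((1 / 2 ^ k) *\<^sub>R x)))) \<le> B * 2 powr (real k * (real CARD('n) / 2 - 1))"
    using R_log_pairing_upper_bound[OF assms] by blast
  have "c * (sqrt 2) ^ k \<le> B" for k
  proof -
    have "schwartz (\<lambda>x. complex_of_real (\<phi>0 ((1 / 2 ^ k) *\<^sub>R x)))"
      using assms(1) schwartz_scaleR[of "\<lambda>\<xi>. complex_of_real (\<phi>0 \<xi>)" "1 / 2 ^ k"] by (simp add: LP_generator_def)
    then have "c * 2 powr (real k * (real CARD('n) - 1) / 2) \<le> B * 2 powr (real k * (real CARD('n) / 2 - 1))"
      using order_trans[OF c(2)[of k]] B[of k] * by auto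
    moreover have "2 powr (real k * (real CARD('n) - 1) / 2) = (sqrt 2) ^ k * 2 powr (real k * (real CARD('n) / 2 - 1))"
    proof -
      have "(sqrt 2) ^ k = 2 powr (real k / 2)"
        by (simp add: powr_half_sqrt[symmetric] powr_power)
      moreover have "real k * (real CARD('n) - 1) / 2 = real k / 2 + real k * (real CARD('n) / 2 - 1)"
        by (simp add: field_simps)
      ultimately show ?thesis by (simp only: powr_add)
    qed
    ultimately have "(c * (sqrt 2) ^ k) * 2 powr (real k * (real CARD('n) / 2 - 1)) \<le> B * 2 powr (real k * (real CARD('n) / 2 - 1))"
      by (simp only: mult.assoc)
    then show ?thesis by (rule mult_right_le_imp_le) simp
  qed
  moreover obtain k where "B / c < (sqrt 2) ^ k"
    using real_arch_pow[of "sqrt 2" "B / c"] by auto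
  ultimately show False
    using c(1) by (metis mult.commute not_le pos_divide_less_eq)
qed

lemma slow_decay_in_T_space:
  fixes \<phi>0 :: "real^'n \<Rightarrow> real"
  assumes "LP_generator \<phi>0" "\<alpha> > 1/2"
  shows "dist_of slow_decay \<in> T_space \<phi>0 (Psi_log \<alpha>)"
proof (rule dist_of_L2_in_T_space[OF assms])
  show meas: "(slow_decay :: real^'n \<Rightarrow> complex) \<in> borel_measurable lebesgue"
    by (intro measurable_completion) (simp add: slow_decay_measurable)
  show "L2_sq (slow_decay :: real^'n \<Rightarrow> complex) < \<infinity>"
    unfolding L2_sq_def slow_decay_square by (rule nn_integral_bracket_finite)
  show "tempered (dist_of (slow_decay :: real^'n \<Rightarrow> complex))"
    by (rule tempered_dist_of[OF meas slow_decay_unit_cube_average])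
qed

text \<open>Functionals count as equal when they agree on Schwartz functions. Strictness therefore
  asks for a \<open>u\<close> that each \<open>f\<close> of the R-space fails to represent on some
  Schwartz function.\<close>

theorem theorem8p5:
  fixes \<alpha> :: real and \<phi>0 :: "real^'n \<Rightarrow> real"
  assumes "CARD('n) \<ge> 2" and "\<alpha> > 1/2" and "LP_generator \<phi>0"
  shows "(\<exists>C::real. \<forall>f\<in>R_log (2 * real CARD('n) / (real CARD('n) + 2)) \<alpha>.
            dist_of f \<in> T_space \<phi>0 (Psi_log \<alpha>) \<and>
            T_sq \<phi>0 (Psi_log \<alpha>) (dist_of f)
              \<le> ennreal C * R_sq (2 * real CARD('n) / (real CARD('n) + 2)) \<alpha> f)
       \<and> (\<exists>u\<in>T_space \<phi>0 (Psi_log \<alpha>).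
            \<forall>f\<in>R_log (2 * real CARD('n) / (real CARD('n) + 2)) \<alpha>.
              \<exists>\<phi>. schwartz \<phi> \<and> u \<phi> \<noteq> dist_of f \<phi>)"
  using R_log_embedding[OF assms] slow_decay_in_T_space[OF assms(3,2)] slow_decay_not_represented_in_R_log[OF assms(3)]
  by blast

end
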